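(* Let $G$ be a finite chordal graph. Then the following are equivalent: (i) the independence complex $\mathrm{Ind}(G)$ is contractible; (ii) $\mathrm{Ind}(G)$ is dismantlable; (iii) the complement graph $\overline{G}$ is dismantlable as a graph.
   Context: A graph is chordal if it has no induced cycle of length more than three. $\mathrm{Ind}(G)$ is the simplicial complex on $V(G)$ whose faces are the independent sets of $G$; $\overline{G}$ is the complement graph. For a simplicial complex $K$, a vertex $u$ is dominated by a vertex $u'\neq u$ if the link $\mathrm{lk}_K(u)$ is a cone with apex $u'$; removing a dominated vertex (passing to the deletion $K\setminus u$) is an elementary dismantling, and $K$ is dismantlable if a sequence of elementary dismantlings reduces it to a single vertex. In a graph $H$, a vertex $u$ is dominated by a vertex $u'\neq u$ if $N_H[u]\subseteq N_H[u']$, where $N_H[u]$ is the closed neighbourhood; $H$ is dismantlable if it can be reduced to a single vertex by successive removals of dominated vertices. *)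

theory Defs
  imports "HOL-Analysis.Analysis"
begin

datatype 'a graph = Graph (verts: "'a set") (edges: "'a set set")

definition simple_graph :: "'a graph \<Rightarrow> bool" where
  "simple_graph G \<longleftrightarrow> (\<forall>e\<in>edges G. e \<subseteq> verts G \<and> card e = 2)"

definition complement_graph :: "'a graph \<Rightarrow> 'a graph" where
  "complement_graph G =
     Graph (verts G) {{u, v} | u v. u \<in> verts G \<and> v \<in> verts G \<and> u \<noteq> v \<and> {u, v} \<notin> edges G}"

text \<open>The list enumerates the vertices of the cycle in cyclic order; the equivalence (rather
  than an implication) says that the cycle has no chords.\<close>

definition induced_cycle :: "'a graph \<Rightarrow> 'a list \<Rightarrow> bool" where
  "induced_cycle G c \<longleftrightarrow>
     length c \<ge> 3 \<and> distinct c \<and> set c \<subseteq> verts G \<and>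
     (\<forall>i<length c. \<forall>j<length c.
        {c ! i, c ! j} \<in> edges G \<longleftrightarrow> j = Suc i mod length c \<or> i = Suc j mod length c)"

definition chordal :: "'a graph \<Rightarrow> bool" where
  "chordal G \<longleftrightarrow> \<not> (\<exists>c. induced_cycle G c \<and> length c > 3)"

definition closed_nbhd :: "'a graph \<Rightarrow> 'a \<Rightarrow> 'a set" where
  "closed_nbhd H u = {v \<in> verts H. v = u \<or> {u, v} \<in> edges H}"

definition graph_dominated :: "'a graph \<Rightarrow> 'a \<Rightarrow> 'a \<Rightarrow> bool" where
  "graph_dominated H u u' \<longleftrightarrow>
     u \<in> verts H \<and> u' \<in> verts H \<and> u' \<noteq> u \<and> closed_nbhd H u \<subseteq> closed_nbhd H u'"

definition delete_vertex :: "'a graph \<Rightarrow> 'a \<Rightarrow> 'a graph" where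
  "delete_vertex H u = Graph (verts H - {u}) {e \<in> edges H. u \<notin> e}"

definition graph_dismantling_step :: "'a graph \<Rightarrow> 'a graph \<Rightarrow> bool" where
  "graph_dismantling_step H H' \<longleftrightarrow> (\<exists>u u'. graph_dominated H u u' \<and> H' = delete_vertex H u)"

definition graph_dismantlable :: "'a graph \<Rightarrow> bool" where
  "graph_dismantlable H \<longleftrightarrow> (\<exists>v. graph_dismantling_step\<^sup>*\<^sup>* H (Graph {v} {}))"

text \<open>A simplicial complex is represented by the set of its faces, including the empty face;
  its vertices are the \<open>v\<close> with \<open>{v}\<close> a face. The complex with a single vertex \<open>v\<close> is
  thus \<open>{{}, {v}}\<close>.\<close>

definition Ind :: "'a graph \<Rightarrow> 'a set set" where
  "Ind G = {S. S \<subseteq> verts G \<and> (\<forall>u\<in>S. \<forall>v\<in>S. {u, v} \<notin> edges G)}"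

definition link :: "'a set set \<Rightarrow> 'a \<Rightarrow> 'a set set" where
  "link K u = {s. u \<notin> s \<and> insert u s \<in> K}"

definition deletion :: "'a set set \<Rightarrow> 'a \<Rightarrow> 'a set set" where
  "deletion K u = {s \<in> K. u \<notin> s}"

text \<open>The apex is required to be a vertex of the cone, so \<open>{}\<close> and \<open>{{}}\<close> are not cones,
  whereas a single vertex is the cone over \<open>{{}}\<close>.\<close>

definition cone_with_apex :: "'a set set \<Rightarrow> 'a \<Rightarrow> bool" where
  "cone_with_apex L a \<longleftrightarrow> {a} \<in> L \<and> (\<forall>s\<in>L. insert a s \<in> L)"

definition complex_dominated :: "'a set set \<Rightarrow> 'a \<Rightarrow> 'a \<Rightarrow> bool" where
  "complex_dominated K u u' \<longleftrightarrow>
     {u} \<in> K \<and> {u'} \<in> K \<and> u' \<noteq> u \<and> cone_with_apex (link K u) u'"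

definition complex_dismantling_step :: "'a set set \<Rightarrow> 'a set set \<Rightarrow> bool" where
  "complex_dismantling_step K K' \<longleftrightarrow> (\<exists>u u'. complex_dominated K u u' \<and> K' = deletion K u)"

definition complex_dismantlable :: "'a set set \<Rightarrow> bool" where
  "complex_dismantlable K \<longleftrightarrow> (\<exists>v. complex_dismantling_step\<^sup>*\<^sup>* K {{}, {v}})"

text \<open>Geometric realization in barycentric coordinates. On a complex with finitely many faces
  the subspace topology used here coincides with the weak topology; for infinite complexes the
  two may differ.\<close>

definition realization :: "'a set set \<Rightarrow> ('a \<Rightarrow> real) topology" where
  "realization K =
     subtopology (powertop_real UNIV)
       {x. (\<forall>v. 0 \<le> x v) \<and> {v. x v \<noteq> 0} \<in> K \<and> (\<Sum>v | x v \<noteq> 0. x v) = 1}"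

text \<open>The library's \<open>contractible_space\<close> holds of the empty space, which is not contractible in
  the usual sense (homotopy equivalent to a point).\<close>

definition complex_contractible :: "'a set set \<Rightarrow> bool" where
  "complex_contractible K \<longleftrightarrow>
     topspace (realization K) \<noteq> {} \<and> contractible_space (realization K)"

end

theory Submission
  imports Defs "HOL-Library.Z2" "HOL-Homology.Brouwer_Degree"
begin

text \<open>Vanishing of the reduced homology of the independence complex (coefficients \<open>\<int>/2\<close>) is the bridge
  between contractibility and dismantlability.

  If \<open>v\<close> is simplicial and the complex of \<open>G - N[w]\<close> is acyclic for every neighbour \<open>w\<close> of \<open>v\<close>,
  then so is that of \<open>G\<close>. Hence a chordal graph whose complex is not acyclic has edges
  \<open>v\<^sub>1w\<^sub>1, v\<^sub>2w\<^sub>2, \<dots>\<close>, with \<open>v\<^sub>i\<close> simplicial in what is left after deleting \<open>N[w\<^sub>1], \<dots>, N[w\<^bsub>i-1\<^esub>]\<close>,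
  that exhaust the graph; these edges span a cross-polytope that is a retract of the
  complex, which is therefore not contractible.

  Conversely let \<open>G\<close> be chordal with acyclic complex, without dominated vertices and with at least
  two vertices. Choose a minimal connected vertex set \<open>M\<close> whose neighbourhood \<open>R\<close> is a clique but
  \<open>M \<union> R\<close> is not, and a maximal clique \<open>P \<supseteq> R\<close> that meets \<open>M\<close>. The vertices of
  \<open>M - P\<close> are then simplicial, and the homology of \<open>G\<close> contains suspensions of that of \<open>C - N[z]\<close>,
  where \<open>C = V - M - R\<close> and \<open>z \<in> R\<close>, and of \<open>C\<close>. So these are acyclic as well, and hence
  replacing \<open>M\<close> by two adjacent vertices joined to all of \<open>R\<close> gives a smaller graph of the same kind.\<close>

section \<open>Homology of independence complexes\<close>

text \<open>Adjacency and vertex set are kept apart, so that an induced subgraph changes only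
  \<open>V\<close>. For \<open>z\<close> in \<open>V\<close>, the set
  \<open>V - closed_nbrs E z\<close> spans the link of \<open>z\<close> and \<open>V - {z}\<close>
  its deletion.\<close>

definition indep :: "('a \<Rightarrow> 'a \<Rightarrow> bool) \<Rightarrow> 'a set \<Rightarrow> 'a set set" where
  "indep E V = {S. S \<subseteq> V \<and> (\<forall>u\<in>S. \<forall>v\<in>S. \<not> E u v)}"

definition closed_nbrs :: "('a \<Rightarrow> 'a \<Rightarrow> bool) \<Rightarrow> 'a \<Rightarrow> 'a set" where
  "closed_nbrs E x = insert x {y. E x y}"

text \<open>Chains of the independence complex are functions from vertex sets to \<open>\<int>/2\<close>; \<open>U\<close> is an ambient finite
  vertex set. All dimensions are treated at once and the empty face counts as a simplex, so
  \<open>Z2_acyclic\<close> says that the reduced homology vanishes.\<close>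

definition bd :: "'a set \<Rightarrow> ('a set \<Rightarrow> bit) \<Rightarrow> 'a set \<Rightarrow> bit" where
  "bd U c s = (\<Sum>x\<in>U - s. c (insert x s))"

definition chain :: "('a \<Rightarrow> 'a \<Rightarrow> bool) \<Rightarrow> 'a set \<Rightarrow> ('a set \<Rightarrow> bit) \<Rightarrow> bool" where
  "chain E V c \<longleftrightarrow> (\<forall>s. c s \<noteq> 0 \<longrightarrow> s \<in> indep E V)"

definition Z2_acyclic :: "'a set \<Rightarrow> ('a \<Rightarrow> 'a \<Rightarrow> bool) \<Rightarrow> 'a set \<Rightarrow> bool" where
  "Z2_acyclic U E V \<longleftrightarrow>
     (\<forall>c. chain E V c \<and> (\<forall>s. bd U c s = 0) \<longrightarrow> (\<exists>e. chain E V e \<and> (\<forall>s. bd U e s = c s)))"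

text \<open>A chain splits as \<open>c = deletion_part z c + cone_chain z (link_part z c)\<close>,
  into its faces avoiding \<open>z\<close> and its faces through \<open>z\<close>.\<close>

definition cone_chain :: "'a \<Rightarrow> ('a set \<Rightarrow> bit) \<Rightarrow> 'a set \<Rightarrow> bit" where
  "cone_chain z c s = (if z \<in> s then c (s - {z}) else 0)"

definition link_part :: "'a \<Rightarrow> ('a set \<Rightarrow> bit) \<Rightarrow> 'a set \<Rightarrow> bit" where
  "link_part z c s = (if z \<in> s then 0 else c (insert z s))"

definition deletion_part :: "'a \<Rightarrow> ('a set \<Rightarrow> bit) \<Rightarrow> 'a set \<Rightarrow> bit" where
  "deletion_part z c s = (if z \<in> s then 0 else c s)"

text \<open>These would rewrite \<open>c s \<noteq> 0\<close> to \<open>c s = 1\<close> and sums to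
  exclusive ors, out of reach of the additive laws used below.\<close>

declare bit_not_zero_iff [simp del] bit_not_one_iff [simp del] add_bit_eq_xor [simp del]

lemma bit_add_self [simp]: "(a::bit) + a = 0" "(a::bit) + (a + b) = b"
  by (cases a; cases b; simp)+

lemma bit_add_eq_0_iff: "(a::bit) + b = 0 \<longleftrightarrow> a = b"
  by (cases a; cases b) simp_all

lemma bd_add: "bd U (\<lambda>s. a s + b s) s = bd U a s + bd U b s"
  by (simp add: bd_def sum.distrib)

lemma chain_mono: "chain E V c \<Longrightarrow> V \<subseteq> W \<Longrightarrow> chain E W c"
  by (fastforce simp: chain_def indep_def)

lemma chain_add: "chain E V a \<Longrightarrow> chain E V b \<Longrightarrow> chain E V (\<lambda>s. a s + b s)"
  unfolding chain_def by (metis add.right_neutral)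

lemma chain_deletion_part: "chain E V c \<Longrightarrow> chain E (V - {z}) (deletion_part z c)"
  by (auto simp: chain_def deletion_part_def indep_def split: if_splits)

lemma Z2_acyclicD:
  assumes "Z2_acyclic U E V" "chain E V c" "\<And>s. bd U c s = 0"
  obtains e where "chain E V e" "\<And>s. bd U e s = c s"
  using assms unfolding Z2_acyclic_def by blast

lemma Z2_acyclic_cong:
  assumes "\<And>x y. x \<in> V \<Longrightarrow> y \<in> V \<Longrightarrow> E x y = E' x y"
  shows "Z2_acyclic U E V \<longleftrightarrow> Z2_acyclic U E' V"
proof -
  have "indep E V = indep E' V"
    using assms by (auto simp: indep_def subset_iff)
  then show ?thesis
    by (simp add: Z2_acyclic_def chain_def)
qed

section \<open>Chain-level homology, split at a vertex\<close>

locale finite_graph =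
  fixes U :: "'a set" and E :: "'a \<Rightarrow> 'a \<Rightarrow> bool"
  assumes fin: "finite U" and sym: "E x y \<Longrightarrow> E y x" and irrefl: "\<not> E x x"
begin

abbreviation acyc where "acyc \<equiv> Z2_acyclic U E"

lemma chain_link_part: "chain E V c \<Longrightarrow> chain E (V - closed_nbrs E z) (link_part z c)"
  by (fastforce simp: chain_def link_part_def indep_def closed_nbrs_def split: if_splits)

lemma chain_cone:
  assumes "chain E (V - closed_nbrs E z) c" "z \<in> V"
  shows "chain E V (cone_chain z c)"
  unfolding chain_def
proof (intro allI impI)
  fix s assume "cone_chain z c s \<noteq> 0"
  then have "z \<in> s" "s - {z} \<in> indep E (V - closed_nbrs E z)"
    using assms(1) by (auto simp: cone_chain_def chain_def split: if_splits)
  then show "s \<in> indep E V"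
    using assms(2) sym irrefl unfolding indep_def closed_nbrs_def by blast
qed

lemma chain_vanishes: "chain E V c \<Longrightarrow> z \<notin> V \<Longrightarrow> z \<in> s \<Longrightarrow> c s = 0"
  by (auto simp: chain_def indep_def)

text \<open>Writing \<open>c = c0 + z c1\<close> with \<open>z\<close> in no face of
  \<open>c0\<close> or \<open>c1\<close>, the boundary is \<open>(bd c0 + c1) + z (bd c1)\<close>,
  without signs modulo 2. This is its part through \<open>z\<close>; \<open>bd_deletion\<close> is
  the part avoiding \<open>z\<close>, and \<open>bd_cone\<close> the case
  \<open>c0 = 0\<close>.\<close>

lemma bd_link:
  assumes "z \<in> s"
  shows "bd U c s = bd U (link_part z c) (s - {z})"
proof -
  have "bd U (link_part z c) (s - {z}) = (\<Sum>x\<in>U - s. link_part z c (insert x (s - {z})))"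
    unfolding bd_def using fin
    by (intro sum.mono_neutral_right) (auto simp: link_part_def)
  also have "\<dots> = bd U c s"
    unfolding bd_def using assms
    by (intro sum.cong) (auto simp: link_part_def insert_absorb insert_commute)
  finally show ?thesis by simp
qed

lemma bd_deletion:
  assumes "z \<notin> s" "z \<in> U"
  shows "bd U c s = bd U (deletion_part z c) s + c (insert z s)"
proof -
  have U: "U - s = insert z (U - s - {z})"
    using assms by auto
  have "bd U c s = c (insert z s) + (\<Sum>x\<in>U - s - {z}. c (insert x s))"
    unfolding bd_def by (subst U, subst sum.insert) (use fin in auto)
  moreover have "(\<Sum>x\<in>U - s - {z}. deletion_part z c (insert x s)) = (\<Sum>x\<in>U - s - {z}. c (insert x s))"
    using assms by (intro sum.cong) (auto simp: deletion_part_def)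
  then have "bd U (deletion_part z c) s = (\<Sum>x\<in>U - s - {z}. c (insert x s))"
    unfolding bd_def by (subst U, subst sum.insert) (use fin in \<open>auto simp: deletion_part_def\<close>)
  ultimately show ?thesis by (simp add: add.commute)
qed

lemma bd_cone:
  assumes "chain E V c" "z \<notin> V" "z \<in> U"
  shows "bd U (cone_chain z c) s = (if z \<in> s then bd U c (s - {z}) else c s)"
proof (cases "z \<in> s")
  case True
  have "link_part z (cone_chain z c) = c"
    using chain_vanishes[OF assms(1,2)] by (auto simp: link_part_def cone_chain_def)
  then show ?thesis using bd_link[OF True, of "cone_chain z c"] True by simp
next
  case False
  have "bd U (deletion_part z (cone_chain z c)) s = 0"
    using False by (auto simp: bd_def deletion_part_def cone_chain_def intro!: sum.neutral)
  then show ?thesis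
    using bd_deletion[OF False assms(3), of "cone_chain z c"] False by (simp add: cone_chain_def)
qed

lemma bd_link_part:
  "bd U (link_part z c) s = (if z \<in> s then 0 else bd U c (insert z s))"
proof (cases "z \<in> s")
  case True
  then show ?thesis by (simp add: bd_def link_part_def)
next
  case False
  then show ?thesis using bd_link[of z "insert z s" c] by simp
qed

lemma bd_vanishes: "chain E V c \<Longrightarrow> z \<notin> V \<Longrightarrow> z \<in> s \<Longrightarrow> bd U c s = 0"
  by (simp add: bd_def chain_vanishes)

text \<open>Mayer-Vietoris for the complex as the deletion of \<open>z\<close> with a cone over the
  link glued on. The link part of a cycle is a cycle, filled by \<open>e1\<close>; adding
  \<open>e1\<close> closes up the deletion part, filled by \<open>e0\<close>; then
  \<open>e0 + z e1\<close> fills the given cycle.\<close>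

lemma acyclic_if_link_deletion:
  assumes "acyc (V - closed_nbrs E z)" "acyc (V - {z})" "z \<in> V" "V \<subseteq> U"
  shows "acyc V"
  unfolding Z2_acyclic_def
proof (intro allI impI)
  fix c assume c: "chain E V c \<and> (\<forall>s. bd U c s = 0)"
  have zU: "z \<in> U" using assms by auto
  have l: "chain E (V - closed_nbrs E z) (link_part z c)" using c chain_link_part by blast
  obtain e1 where e1: "chain E (V - closed_nbrs E z) e1" "\<And>s. bd U e1 s = link_part z c s"
    using Z2_acyclicD[OF assms(1) l] c bd_link_part[of z c] by metis
  have e1': "chain E (V - {z}) e1" by (rule chain_mono[OF e1(1)]) (auto simp: closed_nbrs_def)
  let ?c0 = "\<lambda>s. deletion_part z c s + e1 s"
  have c0: "chain E (V - {z}) ?c0"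
    using c e1' by (intro chain_add chain_deletion_part) auto
  have "bd U ?c0 s = 0" for s
  proof (cases "z \<in> s")
    case True then show ?thesis using bd_vanishes[OF c0, of z] by simp
  next
    case False
    then have "bd U (deletion_part z c) s = c (insert z s)"
      using bd_deletion[OF False zU, of c] c by (simp add: bit_add_eq_0_iff)
    then show ?thesis using False by (simp add: bd_add e1(2) link_part_def)
  qed
  then obtain e0 where e0: "chain E (V - {z}) e0" "\<And>s. bd U e0 s = ?c0 s"
    using Z2_acyclicD[OF assms(2) c0] by blast
  have "chain E V (\<lambda>s. e0 s + cone_chain z e1 s)"
    using e0(1) e1(1) assms(3) by (intro chain_add chain_cone) (auto elim: chain_mono)
  moreover have "bd U (\<lambda>s. e0 s + cone_chain z e1 s) s = c s" for s
  proof -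
    have "bd U (cone_chain z e1) s = (if z \<in> s then bd U e1 (s - {z}) else e1 s)"
      using bd_cone[OF e1(1) _ zU] by (simp add: closed_nbrs_def)
    then show ?thesis
      using chain_vanishes[OF e1', of z s]
      by (auto simp: bd_add e0(2) e1(2) deletion_part_def link_part_def add.assoc insert_absorb)
  qed
  ultimately show "\<exists>e. chain E V e \<and> (\<forall>s. bd U e s = c s)" by blast
qed

text \<open>A cycle \<open>c\<close> avoiding \<open>z\<close> is filled by some \<open>e\<close> in
  the whole complex. The link part of \<open>e\<close> is a cycle, because \<open>c\<close> has no
  face through \<open>z\<close>; trading its cone for a filling \<open>f\<close> inside the link
  pushes \<open>e\<close> off \<open>z\<close>.\<close>

lemma acyclic_deletion:
  assumes "acyc (V - closed_nbrs E z)" "acyc V" "z \<in> V" "V \<subseteq> U"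
  shows "acyc (V - {z})"
  unfolding Z2_acyclic_def
proof (intro allI impI)
  fix c assume c: "chain E (V - {z}) c \<and> (\<forall>s. bd U c s = 0)"
  have zU: "z \<in> U" using assms by auto
  have "chain E V c" using c by (auto elim: chain_mono)
  then obtain e where e: "chain E V e" "\<And>s. bd U e s = c s"
    using Z2_acyclicD[OF assms(2)] c by blast
  have cz: "z \<in> s \<Longrightarrow> c s = 0" for s using c chain_vanishes[of "V - {z}"] by blast
  have "bd U (link_part z e) s = 0" for s
    by (simp add: bd_link_part e(2) cz)
  then obtain f where f: "chain E (V - closed_nbrs E z) f" "\<And>s. bd U f s = link_part z e s"
    using Z2_acyclicD[OF assms(1) chain_link_part[OF e(1)]] by blast
  have f': "chain E (V - {z}) f" by (rule chain_mono[OF f(1)]) (auto simp: closed_nbrs_def)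
  let ?e = "\<lambda>s. deletion_part z e s + f s"
  have che: "chain E (V - {z}) ?e" using e(1) f' by (intro chain_add chain_deletion_part)
  moreover have "bd U ?e s = c s" for s
  proof (cases "z \<in> s")
    case True then show ?thesis using bd_vanishes[OF che, of z] cz by simp
  next
    case False
    then show ?thesis using bd_deletion[OF False zU, of e] by (simp add: bd_add e(2) f(2) link_part_def)
  qed
  ultimately show "\<exists>e. chain E (V - {z}) e \<and> (\<forall>s. bd U e s = c s)" by blast
qed

text \<open>In an acyclic complex the homology of the link injects into that of the deletion:
  \<open>e\<close> and the cone \<open>z c\<close> glue to a cycle, and the link part of any filling
  \<open>g\<close> of it has boundary \<open>c\<close>.\<close>

lemma cycle_bounds_in_link:
  assumes "acyc V" "z \<in> V" "V \<subseteq> U"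
    and c: "chain E (V - closed_nbrs E z) c" "\<And>s. bd U c s = 0"
    and e: "chain E (V - {z}) e" "\<And>s. bd U e s = c s"
  obtains f where "chain E (V - closed_nbrs E z) f" "\<And>s. bd U f s = c s"
proof -
  have zU: "z \<in> U" using assms by auto
  let ?d = "\<lambda>s. e s + cone_chain z c s"
  have "chain E V ?d"
    using e(1) c(1) assms(2) by (intro chain_add chain_cone) (auto elim: chain_mono)
  moreover have "bd U ?d s = 0" for s
  proof -
    have "bd U (cone_chain z c) s = (if z \<in> s then bd U c (s - {z}) else c s)"
      using bd_cone[OF c(1) _ zU] by (simp add: closed_nbrs_def)
    then show ?thesis using bd_vanishes[OF e(1), of z s] by (auto simp: bd_add e(2) c(2))
  qed
  ultimately obtain g where g: "chain E V g" "\<And>s. bd U g s = ?d s"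
    using Z2_acyclicD[OF assms(1)] by blast
  have "bd U (link_part z g) s = c s" for s
  proof (cases "z \<in> s")
    case True
    then have "c s = 0" using chain_vanishes[OF c(1), of z] by (simp add: closed_nbrs_def)
    then show ?thesis using True by (simp add: bd_link_part)
  next
    case False
    then show ?thesis
      using chain_vanishes[OF e(1), of z "insert z s"] by (simp add: bd_link_part g(2) cone_chain_def)
  qed
  then show ?thesis using that chain_link_part[OF g(1)] by blast
qed

text \<open>The complex is a cone with apex \<open>v\<close>; coning off the part of a cycle that
  avoids \<open>v\<close> fills the cycle.\<close>

lemma acyclic_if_isolated:
  assumes "v \<in> V" "V \<subseteq> U" "\<And>x. x \<in> V \<Longrightarrow> \<not> E v x"
  shows "acyc V"
  unfolding Z2_acyclic_def
proof (intro allI impI)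
  fix c assume c: "chain E V c \<and> (\<forall>s. bd U c s = 0)"
  have vU: "v \<in> U" using assms by auto
  have V: "V - closed_nbrs E v = V - {v}" using assms by (auto simp: closed_nbrs_def)
  have d: "chain E (V - {v}) (deletion_part v c)" using c chain_deletion_part[of E V c v] by blast
  have "chain E V (cone_chain v (deletion_part v c))"
    using d V assms(1) by (intro chain_cone) auto
  moreover have "bd U (cone_chain v (deletion_part v c)) s = c s" for s
  proof (cases "v \<in> s")
    case True
    have "bd U (deletion_part v c) (s - {v}) = c s"
      using bd_deletion[of v "s - {v}" c] vU c True by (simp add: bit_add_eq_0_iff insert_absorb)
    then show ?thesis using bd_cone[OF d _ vU] True by simp
  next
    case False
    then show ?thesis using bd_cone[OF d _ vU] by (simp add: deletion_part_def)
  qed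
  ultimately show "\<exists>e. chain E V e \<and> (\<forall>s. bd U e s = c s)" by blast
qed

text \<open>The complex is \<open>{{}}\<close>, a sphere of dimension -1: its empty face is a cycle
  that bounds nothing.\<close>

lemma not_acyclic_empty: "\<not> acyc {}"
proof
  assume a: "acyc {}"
  define c :: "'a set \<Rightarrow> bit" where "c s = (if s = {} then 1 else 0)" for s
  have "chain E {} c" by (auto simp: chain_def c_def indep_def)
  moreover have "bd U c s = 0" for s by (simp add: bd_def c_def)
  ultimately obtain e where e: "chain E {} e" "\<And>s. bd U e s = c s"
    using Z2_acyclicD[OF a] by blast
  have "bd U e {} = 0"
    unfolding bd_def using chain_vanishes[OF e(1)] by (intro sum.neutral) auto
  then show False using e(2)[of "{}"] by (simp add: c_def)
qed

text \<open>A cycle of the link of \<open>w\<close> can be coned off from \<open>v\<close>, so it bounds in the deletion of \<open>w\<close>.\<close>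

lemma acyclic_link_if_dominating_neighbour:
  assumes "acyc V" "V \<subseteq> U" "v \<in> V" "w \<in> V" "E v w" "\<And>x. x \<in> V \<Longrightarrow> E v x \<Longrightarrow> x \<in> closed_nbrs E w"
  shows "acyc (V - closed_nbrs E w)"
  unfolding Z2_acyclic_def
proof (intro allI impI)
  fix c assume c: "chain E (V - closed_nbrs E w) c \<and> (\<forall>s. bd U c s = 0)"
  have vU: "v \<in> U" using assms by auto
  have vw: "v \<in> closed_nbrs E w" "v \<noteq> w" using assms(5) sym irrefl by (auto simp: closed_nbrs_def)
  have sub: "V - closed_nbrs E w \<subseteq> V - {w} - closed_nbrs E v"
    using assms(6) vw by (auto simp: closed_nbrs_def)
  have "chain E (V - {w}) (cone_chain v c)"
    using c sub vw assms(3) by (intro chain_cone) (auto elim: chain_mono)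
  moreover have "bd U (cone_chain v c) s = c s" for s
  proof (cases "v \<in> s")
    case True
    then show ?thesis using bd_cone[of _ c v s] chain_vanishes[of _ c v s] c vU vw(1) by (metis Diff_iff)
  next
    case False
    then show ?thesis using bd_cone[of _ c v s] c vU vw(1) by (metis Diff_iff)
  qed
  ultimately show "\<exists>e. chain E (V - closed_nbrs E w) e \<and> (\<forall>s. bd U e s = c s)"
    using cycle_bounds_in_link[OF assms(1,4,2)] c by metis
qed

text \<open>\<open>Z\<close> lies in the closed neighbourhood of \<open>z\<close>, so the link of
  \<open>z\<close> in \<open>C \<union> Z\<close> has its vertices in \<open>C\<close>. Its cycles
  bound in \<open>C\<close>, hence away from \<open>z\<close>, and so within the link by
  \<open>cycle_bounds_in_link\<close>.\<close>

lemma acyclic_link_if_clique: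
  assumes "acyc C" "acyc (C \<union> Z)" "C \<union> Z \<subseteq> U" "z \<in> Z" "z \<notin> C"
    and Z: "\<And>x y. x \<in> Z \<Longrightarrow> y \<in> Z \<Longrightarrow> x \<noteq> y \<Longrightarrow> E x y"
  shows "acyc (C - closed_nbrs E z)"
proof -
  have eq: "C \<union> Z - closed_nbrs E z = C - closed_nbrs E z"
    using Z assms(4) by (auto simp: closed_nbrs_def)
  show ?thesis
    unfolding Z2_acyclic_def
  proof (intro allI impI)
    fix c assume c: "chain E (C - closed_nbrs E z) c \<and> (\<forall>s. bd U c s = 0)"
    have "chain E C c" using c chain_mono by blast
    then obtain e where e: "chain E C e" "\<And>s. bd U e s = c s"
      using Z2_acyclicD[OF assms(1)] c by blast
    have "chain E (C \<union> Z - {z}) e" using e(1) chain_mono[of E C e "C \<union> Z - {z}"] assms(5) by auto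
    then show "\<exists>e. chain E (C - closed_nbrs E z) e \<and> (\<forall>s. bd U e s = c s)"
      using cycle_bounds_in_link[OF assms(2) _ assms(3), of z c e] c e(2) assms(4) eq
      by (metis UnI2)
  qed
qed

section \<open>Simplicial vertices and acyclicity\<close>

definition simplicial :: "'a set \<Rightarrow> 'a \<Rightarrow> bool" where
  "simplicial V v \<longleftrightarrow> (\<forall>x\<in>V. \<forall>y\<in>V. E v x \<and> E v y \<and> x \<noteq> y \<longrightarrow> E x y)"

lemma simplicial_closed_nbrs:
  assumes "simplicial V v" "w \<in> V" "E v w" "x \<in> V" "E v x"
  shows "x \<in> closed_nbrs E w"
  using assms unfolding simplicial_def closed_nbrs_def by blast

text \<open>Deleting all neighbours of \<open>v\<close> leaves \<open>v\<close> isolated. They are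
  then restored one at a time, \<open>T\<close> being those already restored. The closed
  neighbourhood of each such \<open>w\<close> contains all the others, so its link at that moment is
  already \<open>V - closed_nbrs E w\<close>.\<close>

lemma acyclic_if_simplicial:
  assumes "V \<subseteq> U" "v \<in> V" "simplicial V v"
    and link: "\<And>w. w \<in> V \<Longrightarrow> E v w \<Longrightarrow> acyc (V - closed_nbrs E w)"
  shows "acyc V"
proof -
  have "finite {x \<in> V. E v x}" using assms(1) fin by (simp add: finite_subset)
  moreover have "acyc (V - ({x \<in> V. E v x} - T))" if "finite T" "T \<subseteq> {x \<in> V. E v x}" for T
    using that
  proof (induction T)
    case empty
    show ?case
      using assms(1,2) irrefl by (intro acyclic_if_isolated[of v]) auto
  next
    case (insert w T)
    let ?W = "V - ({x \<in> V. E v x} - insert w T)"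
    have "?W - closed_nbrs E w = V - closed_nbrs E w"
      using insert.prems assms(3) by (auto simp: closed_nbrs_def simplicial_def)
    moreover have "?W - {w} = V - ({x \<in> V. E v x} - T)"
      using insert by auto
    ultimately show ?case
      using insert.IH insert.prems insert.hyps assms(1) link[of w] acyclic_if_link_deletion[of ?W w] by auto
  qed
  from this[of "{x \<in> V. E v x}"] calculation show ?thesis by simp
qed

text \<open>Adjacent simplicial vertices have the same closed neighbourhood in \<open>V\<close>, so
  \<open>B\<close> falls into cliques of at least two twins. Passing to the link of one twin
  \<open>b\<close>, allowed because of its neighbour \<open>a\<close>, removes that whole
  neighbourhood and keeps the other twin classes intact.\<close>

lemma acyclic_strip:
  assumes "acyc V" "V \<subseteq> U" "B \<subseteq> V"
    and "\<And>b. b \<in> B \<Longrightarrow> simplicial V b" "\<And>b. b \<in> B \<Longrightarrow> \<exists>b'\<in>B. E b b'"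
  shows "acyc (V - (\<Union>b\<in>B. closed_nbrs E b))"
  using assms
proof (induction "card B" arbitrary: B V rule: less_induct)
  case less
  show ?case
  proof (cases "B = {}")
    case True then show ?thesis using less.prems(1) by simp
  next
    case False
    then obtain a b where ab: "a \<in> B" "b \<in> B" "E a b"
      using less.prems(5) by blast
    have sa: "simplicial V a" using ab less.prems(4) by auto
    let ?V = "V - closed_nbrs E b" and ?B = "B - closed_nbrs E b"
    have "acyc ?V"
      using less.prems(1-3) ab sa
      by (intro acyclic_link_if_dominating_neighbour[of V a]) (auto simp: simplicial_def closed_nbrs_def)
    moreover have "finite B" using less.prems(2,3) fin by (meson finite_subset)
    then have "card ?B < card B"
      using ab by (intro psubset_card_mono) (auto simp: closed_nbrs_def)
    moreover have "simplicial ?V c" if "c \<in> ?B" for c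
      using that less.prems(4) by (auto simp: simplicial_def)
    moreover have "\<exists>c'\<in>?B. E c c'" if c: "c \<in> ?B" for c
    proof -
      obtain c' where c': "c' \<in> B" "E c c'" using c less.prems(5) by blast
      have "c' \<notin> closed_nbrs E b"
      proof
        assume "c' \<in> closed_nbrs E b"
        then have "c' = b \<or> E c' b" by (auto simp: closed_nbrs_def sym)
        then have "c \<in> closed_nbrs E b"
          using c c' ab less.prems(3,4) sym unfolding simplicial_def closed_nbrs_def
          by (smt (verit) Diff_iff in_mono insert_iff mem_Collect_eq)
        with c show False by simp
      qed
      with c' show ?thesis by blast
    qed
    ultimately have "acyc (?V - (\<Union>b\<in>?B. closed_nbrs E b))"
      using less.prems(2,3) by (intro less.hyps) auto
    moreover have "closed_nbrs E c \<inter> V \<subseteq> closed_nbrs E b" if "c \<in> B" "c \<in> closed_nbrs E b" for c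
      using that less.prems(3,4) ab sym unfolding simplicial_def closed_nbrs_def
      by (smt (verit) IntE in_mono insert_iff mem_Collect_eq subsetI)
    then have "?V - (\<Union>b\<in>?B. closed_nbrs E b) = V - (\<Union>b\<in>B. closed_nbrs E b)"
      using ab by blast
    ultimately show ?thesis by simp
  qed
qed

end

section \<open>Chordal graphs\<close>

definition chordal_on :: "('a \<Rightarrow> 'a \<Rightarrow> bool) \<Rightarrow> 'a set \<Rightarrow> bool" where
  "chordal_on E V \<longleftrightarrow> \<not> (\<exists>c. set c \<subseteq> V \<and> distinct c \<and> length c > 3 \<and>
     (\<forall>i<length c. \<forall>j<length c.
        E (c ! i) (c ! j) \<longleftrightarrow> j = Suc i mod length c \<or> i = Suc j mod length c))"

definition induced_path :: "('a \<Rightarrow> 'a \<Rightarrow> bool) \<Rightarrow> 'a list \<Rightarrow> bool" where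
  "induced_path E p \<longleftrightarrow> p \<noteq> [] \<and> distinct p \<and>
     (\<forall>i<length p. \<forall>j<length p. E (p ! i) (p ! j) \<longleftrightarrow> j = Suc i \<or> i = Suc j)"

lemma chordal_on_mono: "chordal_on E V \<Longrightarrow> W \<subseteq> V \<Longrightarrow> chordal_on E W"
  unfolding chordal_on_def by blast

lemma induced_path_take: "induced_path E p \<Longrightarrow> induced_path E (take (Suc i) p)"
  by (auto simp: induced_path_def)

lemma induced_path_drop:
  assumes "induced_path E p" "i < length p"
  shows "induced_path E (drop i p)"
  using assms by (auto simp: induced_path_def)

context finite_graph
begin

text \<open>A neighbour of \<open>k\<close> in the interior cuts the path into two shorter ones to
  which induction applies; without one, \<open>k\<close> closes a path of at least three vertices to
  a chordless cycle of length at least four.\<close>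

lemma chordal_adjacent_to_path:
  assumes "chordal_on E V" "induced_path E p" "set p \<subseteq> V" "k \<in> V" "k \<notin> set p"
    "E k (hd p)" "E k (last p)"
  shows "\<forall>x\<in>set p. E k x"
  using assms(2,3,5-)
proof (induction "length p" arbitrary: p rule: less_induct)
  case less
  have p: "p \<noteq> []" "distinct p" using less.prems(1) by (auto simp: induced_path_def)
  show ?case
  proof (cases "\<exists>i. 0 < i \<and> Suc i < length p \<and> E k (p ! i)")
    case True
    then obtain i where i: "0 < i" "Suc i < length p" "E k (p ! i)" by blast
    have "\<forall>x\<in>set (take (Suc i) p). E k x"
      using i less.prems p
      by (intro less.hyps induced_path_take)
        (auto simp: last_conv_nth dest: in_set_takeD)
    moreover have "\<forall>x\<in>set (drop i p). E k x"
      using i less.prems p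
      by (intro less.hyps induced_path_drop)
        (auto simp: hd_drop_conv_nth dest: in_set_dropD)
    moreover have "set p \<subseteq> set (take (Suc i) p) \<union> set (drop i p)"
    proof -
      have "set p = set (take i p) \<union> set (drop i p)"
        by (metis append_take_drop_id set_append)
      then show ?thesis using set_take_subset_set_take[of i "Suc i" p] by auto
    qed
    ultimately show ?thesis by blast
  next
    case False
    have iff: "E k (p ! i) \<longleftrightarrow> i = 0 \<or> Suc i = length p" if "i < length p" for i
    proof -
      have "p ! (length p - 1) = last p" "p ! 0 = hd p"
        using p(1) by (simp_all add: last_conv_nth hd_conv_nth)
      then show ?thesis
        using False that less.prems(4,5) by (metis Suc_lessI diff_Suc_1 gr0I)
    qed
    show ?thesis
    proof (cases "length p < 3")
      case True
      then show ?thesis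
        using iff by (auto simp: in_set_conv_nth)
    next
      case False
      let ?c = "k # p" and ?n = "Suc (length p)"
      have "E (?c ! i) (?c ! j) \<longleftrightarrow> j = Suc i mod ?n \<or> i = Suc j mod ?n"
        if ij: "i < ?n" "j < ?n" for i j
      proof -
        have md: "Suc i mod ?n = (if i = length p then 0 else Suc i)"
          "Suc j mod ?n = (if j = length p then 0 else Suc j)" using ij by auto
        show ?thesis
        proof (cases i)
          case 0
          show ?thesis
          proof (cases j)
            case 0 with \<open>i = 0\<close> False show ?thesis unfolding md by (auto simp: irrefl)
          next
            case (Suc j')
            then show ?thesis using iff[of j'] ij False \<open>i = 0\<close> unfolding md by auto
          qed
        next
          case (Suc i')
          show ?thesis
          proof (cases j)
            case 0
            have "E (?c ! i) (?c ! j) \<longleftrightarrow> E k (p ! i')" using 0 Suc sym by auto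
            then show ?thesis using iff[of i'] ij False Suc 0 unfolding md by auto
          next
            case (Suc j')
            have "E (p ! i') (p ! j') \<longleftrightarrow> j' = Suc i' \<or> i' = Suc j'"
              using less.prems(1) ij Suc \<open>i = Suc i'\<close> by (auto simp: induced_path_def)
            then have "E (?c ! i) (?c ! j) \<longleftrightarrow> j = Suc i \<or> i = Suc j"
              using Suc \<open>i = Suc i'\<close> by simp
            moreover have "j \<noteq> 0" "i \<noteq> 0" "j \<le> length p" "i \<le> length p"
              using ij Suc \<open>i = Suc i'\<close> by simp_all
            ultimately show ?thesis unfolding md by (metis not_less_eq_eq)
          qed
        qed
      qed
      then have "\<forall>i<length ?c. \<forall>j<length ?c. E (?c ! i) (?c ! j) \<longleftrightarrow>
          j = Suc i mod length ?c \<or> i = Suc j mod length ?c"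
        by (metis length_Cons)
      moreover have "set ?c \<subseteq> V" "distinct ?c" "length ?c > 3"
        using False p(2) less.prems(2,3) assms(4) by auto
      ultimately have "\<not> chordal_on E V" unfolding chordal_on_def by blast
      with assms(1) show ?thesis by blast
    qed
  qed
qed

section \<open>Connected sets, induced paths and clique separators\<close>

definition adj_in :: "'a set \<Rightarrow> 'a \<Rightarrow> 'a \<Rightarrow> bool" where
  "adj_in A u v \<longleftrightarrow> u \<in> A \<and> v \<in> A \<and> E u v"

definition connected_in :: "'a set \<Rightarrow> bool" where
  "connected_in A \<longleftrightarrow> A \<noteq> {} \<and> (\<forall>x\<in>A. \<forall>y\<in>A. (adj_in A)\<^sup>*\<^sup>* x y)"

lemma adj_in_mono: "(adj_in A)\<^sup>*\<^sup>* x y \<Longrightarrow> A \<subseteq> B \<Longrightarrow> (adj_in B)\<^sup>*\<^sup>* x y"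
  by (erule rtranclp_mono[THEN predicate2D, rotated]) (auto simp: adj_in_def)

lemma adj_in_sym: "(adj_in A)\<^sup>*\<^sup>* x y \<Longrightarrow> (adj_in A)\<^sup>*\<^sup>* y x"
proof (induction rule: rtranclp_induct)
  case (step y z)
  then have "adj_in A z y" by (auto simp: adj_in_def sym)
  then show ?case using step.IH by (rule converse_rtranclp_into_rtranclp)
qed auto

text \<open>The path stays chordless while a walk is followed: a new endpoint \<open>z\<close>
  already on it truncates it there; otherwise it is cut after its first vertex adjacent to
  \<open>z\<close>, and \<open>z\<close> is appended.\<close>

lemma exists_induced_path:
  assumes "(adj_in A)\<^sup>*\<^sup>* x y" "x \<in> A"
  shows "\<exists>p. induced_path E p \<and> hd p = x \<and> last p = y \<and> set p \<subseteq> A"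
  using assms(1)
proof (induction rule: rtranclp_induct)
  case base
  show ?case using assms(2) irrefl by (intro exI[of _ "[x]"]) (auto simp: induced_path_def)
next
  case (step y z)
  then obtain p where p: "induced_path E p" "hd p = x" "last p = y" "set p \<subseteq> A" by blast
  have z: "z \<in> A" "E y z" using step.hyps by (auto simp: adj_in_def)
  have pn: "p \<noteq> []" "distinct p" using p(1) by (auto simp: induced_path_def)
  show ?case
  proof (cases "z \<in> set p")
    case True
    then obtain i where i: "i < length p" "p ! i = z" by (auto simp: in_set_conv_nth)
    have "last (take (Suc i) p) = z" using i by (simp add: take_Suc_conv_app_nth)
    then show ?thesis
      using p induced_path_take[OF p(1), of i] pn
      by (intro exI[of _ "take (Suc i) p"]) (auto dest: in_set_takeD)
  next
    case False
    define P where "P i \<longleftrightarrow> i < length p \<and> E (p ! i) z" for i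
    define i where "i = (LEAST i. P i)"
    have "P (length p - 1)" using pn p(3) z by (simp add: P_def last_conv_nth)
    then have Pi: "P i" unfolding i_def by (rule LeastI)
    have mi: "\<not> P j" if "j < i" for j using that unfolding i_def by (rule not_less_Least)
    let ?q = "take (Suc i) p @ [z]"
    have len: "length (take (Suc i) p) = Suc i" using Pi by (simp add: P_def)
    have Ez: "E (p ! j) z \<longleftrightarrow> j = i" if "j \<le> i" for j
      using that mi[of j] Pi by (auto simp: P_def le_less)
    have nth: "?q ! j = (if j \<le> i then p ! j else z)" if "j \<le> Suc i" for j
      using that len by (auto simp: nth_append)
    have "E (?q ! a) (?q ! b) \<longleftrightarrow> b = Suc a \<or> a = Suc b" if ab: "a \<le> Suc i" "b \<le> Suc i" for a b
    proof -
      have "E (p ! a) (p ! b) \<longleftrightarrow> b = Suc a \<or> a = Suc b" if "a \<le> i" "b \<le> i"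
        using p(1) Pi that by (auto simp: induced_path_def P_def)
      moreover have "E z (p ! b) \<longleftrightarrow> b = i" if "b \<le> i" using Ez[OF that] sym by blast
      ultimately show ?thesis
        using ab Ez[of a] irrefl by (auto simp: nth le_Suc_eq)
    qed
    then have "induced_path E ?q"
      using False pn len by (auto simp: induced_path_def dest: in_set_takeD)
    moreover have "hd ?q = x" using p(2) pn by (cases p) auto
    ultimately show ?thesis
      using p(4) z by (intro exI[of _ ?q]) (auto dest: in_set_takeD)
  qed
qed

text \<open>A vertex \<open>y\<close> of \<open>A\<close> with the most neighbours in
  \<open>K\<close> works. If it missed \<open>k\<close>, then on an induced path from
  \<open>y\<close> through \<open>A\<close> to \<open>k\<close> the vertex before \<open>k\<close>
  would be adjacent to \<open>k\<close> and, by \<open>chordal_adjacent_to_path\<close>, to every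
  neighbour of \<open>y\<close> in the clique \<open>K\<close>.\<close>

lemma chordal_complete_vertex:
  assumes "chordal_on E V" "connected_in A" "A \<subseteq> V" "K \<subseteq> V - A" "finite K"
    and clique: "\<And>x y. x \<in> K \<Longrightarrow> y \<in> K \<Longrightarrow> x \<noteq> y \<Longrightarrow> E x y"
    and nb: "\<And>k. k \<in> K \<Longrightarrow> \<exists>a\<in>A. E k a"
  obtains y where "y \<in> A" "\<And>k. k \<in> K \<Longrightarrow> E y k"
proof -
  let ?f = "\<lambda>z. card {k \<in> K. E z k}"
  have "A \<noteq> {}" using assms(2) by (auto simp: connected_in_def)
  moreover have fi: "finite (?f ` A)"
    by (rule finite_subset[of _ "{..card K}"]) (auto intro: card_mono assms(5))
  ultimately have "Max (?f ` A) \<in> ?f ` A" by (intro Max_in) auto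
  then obtain y where y: "y \<in> A" "Max (?f ` A) = ?f y" by blast
  have max: "?f z \<le> ?f y" if "z \<in> A" for z
    using Max_ge[OF fi, of "?f z"] that y(2) by simp
  have "E y k" if k: "k \<in> K" for k
  proof (rule ccontr)
    assume nyk: "\<not> E y k"
    obtain a where a: "a \<in> A" "E k a" using nb k by blast
    have "(adj_in A)\<^sup>*\<^sup>* y a" using assms(2) y a by (auto simp: connected_in_def)
    then have "(adj_in (insert k A))\<^sup>*\<^sup>* y a" by (rule adj_in_mono) auto
    then have "(adj_in (insert k A))\<^sup>*\<^sup>* y k"
      using a sym by (auto simp: adj_in_def intro: rtranclp.rtrancl_into_rtrancl)
    then obtain p where p: "induced_path E p" "hd p = y" "last p = k" "set p \<subseteq> insert k A"
      using exists_induced_path y(1) by blast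
    have kA: "k \<notin> A" using k assms(4) by blast
    define n where "n = length p - 2"
    have pn: "p \<noteq> []" "distinct p" using p(1) by (auto simp: induced_path_def)
    have len: "length p = Suc (Suc n)"
    proof -
      have "length p \<noteq> 1" using p(2,3) y(1) kA by (auto simp: length_Suc_conv)
      then show ?thesis using pn unfolding n_def by (cases p; cases "tl p"; simp)
    qed
    define y' where "y' = p ! n"
    have pk: "p ! Suc n = k" using p(3) pn len by (simp add: last_conv_nth)
    have y'k: "E y' k" using p(1) len pk unfolding y'_def induced_path_def by force
    have y'p: "y' \<in> set p" using len by (simp add: y'_def)
    then have y'A: "y' \<in> A" using p(4) y'k irrefl by blast
    have "E y' k'" if k': "k' \<in> K" "E y k'" for k'
    proof -
      have "k' \<noteq> k" "k' \<notin> set p" using k' nyk p(4) assms(4) by auto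
      then have "\<forall>x\<in>set p. E k' x"
        using p k k' assms(3,4) sym clique
        by (intro chordal_adjacent_to_path[OF assms(1) p(1)]) auto
      then show ?thesis using y'p sym by blast
    qed
    then have "insert k {k \<in> K. E y k} \<subseteq> {k \<in> K. E y' k}" using y'k k by auto
    then have "card (insert k {k \<in> K. E y k}) \<le> card {k \<in> K. E y' k}"
      using assms(5) by (intro card_mono) auto
    then show False using max[OF y'A] nyk assms(5) by simp
  qed
  with y(1) that show ?thesis by blast
qed

text \<open>\<open>x\<close> is adjacent to both ends of an induced path from \<open>a\<close> to
  \<open>b\<close> through \<open>D\<close>, hence to all of it. If \<open>a\<close> and
  \<open>b\<close> were not adjacent, its second vertex would lie in \<open>D\<close>, which avoids
  N[x].\<close>

lemma chordal_separator_clique: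
  assumes "chordal_on E V" "connected_in D" "D \<subseteq> V" "x \<in> V" "D \<inter> closed_nbrs E x = {}"
    and ab: "a \<in> V" "b \<in> V" "a \<noteq> b" "E x a" "E x b" "\<exists>d\<in>D. E a d" "\<exists>d\<in>D. E b d"
  shows "E a b"
proof (rule ccontr)
  assume nab: "\<not> E a b"
  let ?W = "insert a (insert b D)"
  obtain d e where de: "d \<in> D" "E a d" "e \<in> D" "E b e" using ab by blast
  have "(adj_in D)\<^sup>*\<^sup>* d e" using assms(2) de by (auto simp: connected_in_def)
  then have "(adj_in ?W)\<^sup>*\<^sup>* d e" by (rule adj_in_mono) auto
  moreover have "adj_in ?W a d" "adj_in ?W e b" using de sym by (auto simp: adj_in_def)
  ultimately have "(adj_in ?W)\<^sup>*\<^sup>* a b" by (meson converse_rtranclp_into_rtranclp rtranclp.rtrancl_into_rtrancl)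
  then obtain p where p: "induced_path E p" "hd p = a" "last p = b" "set p \<subseteq> ?W"
    using exists_induced_path by blast
  have "x \<notin> ?W" using assms(5) ab irrefl by (auto simp: closed_nbrs_def)
  then have all: "\<forall>y\<in>set p. E x y"
    using p ab assms(3,4) by (intro chordal_adjacent_to_path[OF assms(1) p(1)]) auto
  have len: "length p > 1" using p ab(3) by (cases p; cases "tl p") (auto simp: induced_path_def)
  have "p ! 0 = a" using p(2) len by (cases p) auto
  moreover have "E (p ! 0) (p ! 1)" using p(1) len unfolding induced_path_def
    by (metis One_nat_def less_trans zero_less_one)
  ultimately have "p ! 1 \<noteq> a" "p ! 1 \<noteq> b" using nab irrefl by auto
  then have "p ! 1 \<in> D" "E x (p ! 1)" using p(4) all nth_mem[OF len] by blast+
  then show False using assms(5) by (auto simp: closed_nbrs_def)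
qed

text \<open>The reflexive closure makes this \<open>{x}\<close> when \<open>x\<close> lies outside
  \<open>A\<close>; hence the premise \<open>x \<in> A\<close> of \<open>component_subset\<close>
  and \<open>component_closed\<close>.\<close>

definition component :: "'a set \<Rightarrow> 'a \<Rightarrow> 'a set" where
  "component A x = {y. (adj_in A)\<^sup>*\<^sup>* x y}"

lemma component_subset: "x \<in> A \<Longrightarrow> component A x \<subseteq> A"
  by (auto simp: component_def adj_in_def elim: rtranclp.cases)

lemma component_closed: "y \<in> component A x \<Longrightarrow> x \<in> A \<Longrightarrow> z \<in> A \<Longrightarrow> E y z \<Longrightarrow> z \<in> component A x"
  using component_subset[of x A]
  by (auto simp: component_def adj_in_def intro!: rtranclp.rtrancl_into_rtrancl[of _ x y z])

lemma component_self [simp]: "x \<in> component A x"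
  by (simp add: component_def)

lemma connected_component: "connected_in (component A x)"
proof -
  have "(adj_in (component A x))\<^sup>*\<^sup>* x y" if "(adj_in A)\<^sup>*\<^sup>* x y" for y
    using that
  proof (induction rule: rtranclp_induct)
    case (step y z)
    then have "adj_in (component A x) y z"
      by (auto simp: adj_in_def component_def intro: rtranclp.rtrancl_into_rtrancl)
    then show ?case using step.IH by (meson rtranclp.rtrancl_into_rtrancl)
  qed auto
  then have "(adj_in (component A x))\<^sup>*\<^sup>* x y" if "y \<in> component A x" for y
    using that by (simp add: component_def)
  then show ?thesis
    unfolding connected_in_def by (metis adj_in_sym component_self empty_iff rtranclp_trans)
qed

text \<open>Dirac's theorem, with a prescribed closed neighbourhood to avoid. \<open>D\<close> is a
  component beyond N[x] and \<open>K\<close> its boundary, a clique of neighbours of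
  \<open>x\<close>. Induction on \<open>D \<union> K\<close>, which misses \<open>x\<close>, yields
  a simplicial vertex in \<open>D\<close>, and this has no neighbours elsewhere.\<close>

lemma simplicial_nonneighbour:
  assumes "chordal_on E V" "V \<subseteq> U" "x \<in> V" "y \<in> V" "y \<notin> closed_nbrs E x"
  obtains v where "v \<in> V" "v \<notin> closed_nbrs E x" "simplicial V v"
proof -
  have "\<exists>v\<in>V - closed_nbrs E x. simplicial V v"
    using assms
  proof (induction "card V" arbitrary: V x y rule: less_induct)
    case less
    have y: "y \<in> V - closed_nbrs E x" using less.prems by auto
    define D where "D = component (V - closed_nbrs E x) y"
    define K where "K = {k \<in> V - D. \<exists>d\<in>D. E k d}"
    have D: "connected_in D" "D \<subseteq> V - closed_nbrs E x" "y \<in> D"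
      unfolding D_def using component_subset[OF y] connected_component by auto
    have Kx: "E x k" if k: "k \<in> K" for k
    proof -
      obtain d where d: "d \<in> D" "E k d" "k \<notin> D" "k \<in> V" using k by (auto simp: K_def)
      then have "k \<in> closed_nbrs E x" using component_closed[OF _ y, of d k] sym unfolding D_def by blast
      moreover have "k \<noteq> x" using d D by (auto simp: closed_nbrs_def)
      ultimately show ?thesis by (simp add: closed_nbrs_def)
    qed
    have Kc: "E a b" if "a \<in> K" "b \<in> K" "a \<noteq> b" for a b
      using that Kx D less.prems(1,3)
      by (intro chordal_separator_clique[of V D x a b]) (auto simp: K_def)
    let ?H = "D \<union> K"
    have H: "?H \<subseteq> V" "x \<notin> ?H" using D Kx irrefl by (auto simp: K_def closed_nbrs_def)
    have finV: "finite V" using less.prems(2) fin by (rule finite_subset)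
    have card: "card ?H < card V" using H less.prems(3) finV by (intro psubset_card_mono) auto
    have IH: "\<exists>v\<in>?H - closed_nbrs E p. simplicial ?H v" if "p \<in> ?H" "q \<in> ?H" "q \<notin> closed_nbrs E p" for p q
      using less.hyps[OF card _ _ that] less.prems(1,2) H chordal_on_mono by blast
    have "\<exists>v\<in>D. simplicial ?H v"
    \<comment> \<open>Induction at a vertex of \<open>K\<close> with a non-neighbour finds a vertex
      outside the clique \<open>K\<close>. If all of \<open>K\<close> is adjacent to everything,
      induction at some \<open>p\<close> of \<open>D\<close> also avoids \<open>K\<close>. In the
      last case the graph is complete.\<close>
    proof (cases "\<exists>k\<in>K. \<exists>q\<in>?H. q \<notin> closed_nbrs E k")
      case True
      then obtain k q where kq: "k \<in> K" "q \<in> ?H" "q \<notin> closed_nbrs E k" by blast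
      then obtain v where "v \<in> ?H - closed_nbrs E k" "simplicial ?H v" using IH[of k q] by blast
      then show ?thesis using Kc kq by (auto simp: closed_nbrs_def)
    next
      case f: False
      show ?thesis
      proof (cases "\<exists>p\<in>D. \<exists>q\<in>?H. q \<notin> closed_nbrs E p")
        case True
        then obtain p q where pq: "p \<in> D" "q \<in> ?H" "q \<notin> closed_nbrs E p" by blast
        then obtain v where v: "v \<in> ?H - closed_nbrs E p" "simplicial ?H v" using IH[of p q] by blast
        have "v \<notin> K"
        proof
          assume "v \<in> K"
          then have "p \<in> closed_nbrs E v" using f pq by blast
          then show False using v sym by (auto simp: closed_nbrs_def)
        qed
        then show ?thesis using v by blast
      next
        case False
        then have "\<forall>p\<in>?H. \<forall>q\<in>?H. q \<in> closed_nbrs E p" using f by blast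
        then have "simplicial ?H y" unfolding simplicial_def closed_nbrs_def
          by (metis insert_iff mem_Collect_eq)
        then show ?thesis using D by blast
      qed
    qed
    then obtain v where v: "v \<in> D" "simplicial ?H v" by blast
    have "u \<in> ?H" if "u \<in> V" "E v u" for u using that v sym by (auto simp: K_def)
    then have "simplicial V v" using v by (auto simp: simplicial_def)
    then show ?case using v D by blast
  qed
  then show ?thesis using that by blast
qed

lemma exists_simplicial:
  assumes "chordal_on E V" "V \<subseteq> U" "V \<noteq> {}"
  obtains v where "v \<in> V" "simplicial V v"
proof (cases "\<exists>x\<in>V. \<exists>y\<in>V. y \<notin> closed_nbrs E x")
  case True
  then show ?thesis using simplicial_nonneighbour[OF assms(1,2)] that by blast
next
  case False
  then have "\<forall>p\<in>V. \<forall>q\<in>V. q \<in> closed_nbrs E p" by blast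
  then have "simplicial V v" for v unfolding simplicial_def closed_nbrs_def
    by (metis insert_iff mem_Collect_eq)
  then show ?thesis using that assms(3) by blast
qed

end

section \<open>Spherical retracts\<close>

text \<open>Domination in the complement graph, so the inclusion of neighbourhoods is reversed. For
  irreflexive \<open>E\<close> the choice \<open>x = u\<close> gives
  \<open>\<not> E u' u\<close>.\<close>

definition dominated :: "('a \<Rightarrow> 'a \<Rightarrow> bool) \<Rightarrow> 'a set \<Rightarrow> 'a \<Rightarrow> 'a \<Rightarrow> bool" where
  "dominated E V u u' \<longleftrightarrow> u \<in> V \<and> u' \<in> V \<and> u \<noteq> u' \<and> (\<forall>x\<in>V. E u' x \<longrightarrow> E u x)"

text \<open>The points \<open>pt i b\<close> span the boundary of a \<open>d\<close>-dimensional cross-polytope inside the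
  independence complex, and \<open>u \<mapsto> (idx u, sg u)\<close> is a simplicial retraction onto it.\<close>

definition sphere_cert :: "('a \<Rightarrow> 'a \<Rightarrow> bool) \<Rightarrow> 'a set \<Rightarrow> nat \<Rightarrow> bool" where
  "sphere_cert E V d \<longleftrightarrow> (\<exists>idx sg pt.
     (\<forall>u\<in>V. idx u < d) \<and>
     (\<forall>u\<in>V. \<forall>u'\<in>V. idx u = idx u' \<and> sg u \<noteq> sg u' \<longrightarrow> E u u') \<and>
     (\<forall>i<d. \<forall>b. pt i b \<in> V \<and> idx (pt i b) = i \<and> sg (pt i b) = (b::bool)) \<and>
     (\<forall>i<d. \<forall>j<d. \<forall>b b'. i \<noteq> j \<longrightarrow> \<not> E (pt i b) (pt j b')))"

context finite_graph
begin

text \<open>The new poles are \<open>v\<close> and \<open>w\<close>; neither has a neighbour in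
  \<open>V\<close> outside N[w], for \<open>v\<close> by the last premise. All of N[w] except
  \<open>w\<close> is retracted to \<open>v\<close>, which is allowed because it is adjacent to
  \<open>w\<close>.\<close>

lemma sphere_cert_suspension:
  assumes "sphere_cert E (V - closed_nbrs E w) d" "v \<in> V" "w \<in> V" "E v w"
    "\<And>x. x \<in> V \<Longrightarrow> E v x \<Longrightarrow> x \<in> closed_nbrs E w"
  shows "sphere_cert E V (Suc d)"
proof -
  obtain idx sg pt where 1: "\<forall>u\<in>V - closed_nbrs E w. idx u < d"
    and 2: "\<forall>u\<in>V - closed_nbrs E w. \<forall>u'\<in>V - closed_nbrs E w. idx u = idx u' \<and> sg u \<noteq> sg u' \<longrightarrow> E u u'"
    and 3: "\<forall>i<d. \<forall>b. pt i b \<in> V - closed_nbrs E w \<and> idx (pt i b) = i \<and> sg (pt i b) = (b::bool)"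
    and 4: "\<forall>i<d. \<forall>j<d. \<forall>b b'. i \<noteq> j \<longrightarrow> \<not> E (pt i b) (pt j b')"
    using assms(1) unfolding sphere_cert_def by (elim exE conjE) (rule that)
  define idx' where "idx' u = (if u \<in> closed_nbrs E w then d else idx u)" for u
  define sg' where "sg' u = (if u \<in> closed_nbrs E w then u \<noteq> w else sg u)" for u
  define pt' where "pt' i b = (if i = d then if b then v else w else pt i b)" for i b
  have vw: "v \<in> closed_nbrs E w" "w \<in> closed_nbrs E w" "v \<noteq> w" using assms(4) sym irrefl by (auto simp: closed_nbrs_def)
  have "\<forall>u\<in>V. idx' u < Suc d" using 1 by (auto simp: idx'_def less_SucI)
  moreover have "\<forall>u\<in>V. \<forall>u'\<in>V. idx' u = idx' u' \<and> sg' u \<noteq> sg' u' \<longrightarrow> E u u'"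
  proof (intro ballI impI)
    fix u u' assume u: "u \<in> V" "u' \<in> V" "idx' u = idx' u' \<and> sg' u \<noteq> sg' u'"
    show "E u u'"
    proof (cases "u \<in> closed_nbrs E w")
      case True
      then have "u' \<in> closed_nbrs E w" using u 1 by (auto simp: idx'_def split: if_splits)
      then show ?thesis using u True sym by (auto simp: sg'_def closed_nbrs_def)
    next
      case False
      then have "u' \<notin> closed_nbrs E w" using u 1 by (auto simp: idx'_def split: if_splits)
      then show ?thesis using u False 2 by (auto simp: sg'_def idx'_def)
    qed
  qed
  moreover have "\<forall>i<Suc d. \<forall>b. pt' i b \<in> V \<and> idx' (pt' i b) = i \<and> sg' (pt' i b) = b"
    using 3 vw assms(2,3) by (auto simp: pt'_def idx'_def sg'_def less_Suc_eq)
  moreover have "\<not> E (pt' i b) (pt' j b')" if "i < j" "j < Suc d" for i j b b'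
  proof (cases "j = d")
    case True
    then have p: "pt i b \<in> V - closed_nbrs E w" using that 3 by auto
    then have "\<not> E v (pt i b)" "\<not> E w (pt i b)" using assms(5) by (auto simp: closed_nbrs_def)
    then show ?thesis using True that sym by (auto simp: pt'_def)
  next
    case False
    then show ?thesis using that 4 by (auto simp: pt'_def)
  qed
  then have "\<forall>i<Suc d. \<forall>j<Suc d. \<forall>b b'. i \<noteq> j \<longrightarrow> \<not> E (pt' i b) (pt' j b')"
    using sym by (metis nat_neq_iff)
  ultimately show ?thesis unfolding sphere_cert_def by blast
qed

lemma sphere_cert_if_not_acyclic:
  assumes "chordal_on E V" "V \<subseteq> U" "\<not> acyc V"
  shows "\<exists>d. sphere_cert E V d"
  using assms
proof (induction "card V" arbitrary: V rule: less_induct)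
  case less
  show ?case
  proof (cases "V = {}")
    case True
    then have "sphere_cert E V 0" by (simp add: sphere_cert_def)
    then show ?thesis by blast
  next
    case False
    then obtain v where v: "v \<in> V" "simplicial V v" using exists_simplicial less.prems by metis
    then obtain w where w: "w \<in> V" "E v w" "\<not> acyc (V - closed_nbrs E w)"
      using acyclic_if_simplicial less.prems by blast
    have "finite V" using less.prems(2) fin by (rule finite_subset)
    then have "card (V - closed_nbrs E w) < card V"
      using w by (intro psubset_card_mono) (auto simp: closed_nbrs_def)
    then obtain d where "sphere_cert E (V - closed_nbrs E w) d"
      using less.hyps[of "V - closed_nbrs E w"] w(3) less.prems chordal_on_mono by blast
    then have "sphere_cert E V (Suc d)"
      by (rule sphere_cert_suspension[of V w d v]) (use v w simplicial_closed_nbrs in blast)+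
    then show ?thesis by blast
  qed
qed

text \<open>The two neighbours of \<open>v\<close> on a chordless cycle would be adjacent, which is
  a chord as the cycle has more than three vertices.\<close>

lemma chordal_on_if_simplicial:
  assumes "chordal_on E (V - {v})" "simplicial V v"
  shows "chordal_on E V"
  unfolding chordal_on_def
proof clarify
  fix c assume c: "set c \<subseteq> V" "distinct c" "3 < length c"
    and iff: "\<forall>i<length c. \<forall>j<length c.
      E (c ! i) (c ! j) \<longleftrightarrow> j = Suc i mod length c \<or> i = Suc j mod length c"
  have "v \<in> set c"
    using assms(1) c iff unfolding chordal_on_def by blast
  then obtain i where i: "i < length c" "c ! i = v" by (auto simp: in_set_conv_nth)
  define a where "a = (if Suc i = length c then 0 else Suc i)"
  define b where "b = (if i = 0 then length c - 1 else i - 1)"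
  have ab: "a < length c" "b < length c" "a \<noteq> b"
    using i c(3) by (auto simp: a_def b_def)
  have md: "Suc i mod length c = a" "Suc b mod length c = i"
    using i c(3) by (auto simp: a_def b_def)
  have "E v (c ! a)" "E v (c ! b)" using iff i ab md by auto
  moreover have "c ! a \<noteq> c ! b" using ab c(2) by (simp add: nth_eq_iff_index_eq)
  moreover have "c ! a \<in> V" "c ! b \<in> V" using ab c(1) by auto
  ultimately have "E (c ! a) (c ! b)" using assms(2) by (auto simp: simplicial_def)
  then have "b = Suc a mod length c \<or> a = Suc b mod length c" using iff ab by blast
  moreover have "Suc a mod length c = (if Suc a = length c then 0 else Suc a)" using ab by auto
  ultimately show False using md i c(3) by (auto simp: a_def b_def split: if_splits)
qed

text \<open>Every neighbour of \<open>u'\<close> is a neighbour of \<open>u\<close>, so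
  \<open>u'\<close> is isolated in the link of \<open>u\<close>, which is therefore a cone.\<close>

lemma acyclic_deletion_dominated:
  assumes "acyc V" "V \<subseteq> U" "dominated E V u u'"
  shows "acyc (V - {u})"
proof (rule acyclic_deletion[of V u])
  show "acyc (V - closed_nbrs E u)"
    using assms(2,3) irrefl sym by (intro acyclic_if_isolated[of u']) (auto simp: dominated_def closed_nbrs_def)
qed (use assms in \<open>auto simp: dominated_def\<close>)

lemma exists_maximal_clique:
  assumes "finite V" "Q \<subseteq> V" "\<And>x y. x \<in> Q \<Longrightarrow> y \<in> Q \<Longrightarrow> x \<noteq> y \<Longrightarrow> E x y"
  obtains P where "Q \<subseteq> P" "P \<subseteq> V" "\<And>x y. x \<in> P \<Longrightarrow> y \<in> P \<Longrightarrow> x \<noteq> y \<Longrightarrow> E x y"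
    "\<And>a. a \<in> V \<Longrightarrow> a \<notin> P \<Longrightarrow> \<exists>u\<in>P. \<not> E u a"
proof -
  let ?C = "{P. Q \<subseteq> P \<and> P \<subseteq> V \<and> (\<forall>x\<in>P. \<forall>y\<in>P. x \<noteq> y \<longrightarrow> E x y)}"
  have "finite ?C" by (rule finite_subset[of _ "Pow V"]) (use assms(1) in auto)
  moreover have "Q \<in> ?C" using assms by blast
  ultimately obtain P where P: "P \<in> ?C" "\<forall>P'\<in>?C. P \<subseteq> P' \<longrightarrow> P = P'"
    using finite_has_maximal[of ?C] by (metis (no_types, lifting) empty_iff)
  have "\<exists>u\<in>P. \<not> E u a" if a: "a \<in> V" "a \<notin> P" for a
  proof (rule ccontr)
    assume "\<not> ?thesis"
    then have "insert a P \<in> ?C" using P(1) a sym by auto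
    then have "P = insert a P" using bspec[OF P(2), of "insert a P"] by blast
    then show False using a by blast
  qed
  moreover have "Q \<subseteq> P" "P \<subseteq> V" "\<forall>x\<in>P. \<forall>y\<in>P. x \<noteq> y \<longrightarrow> E x y" using P(1) by simp_all
  ultimately show ?thesis by (intro that[of P]) simp_all
qed

end

section \<open>Acyclic chordal graphs without dominated vertices\<close>

lemma acyclic_undominated_singleton:
  assumes "finite_graph U E" "V \<subseteq> U" "chordal_on E V" "Z2_acyclic U E V"
    "\<And>u u'. \<not> dominated E V u u'"
  shows "card V = 1"
  using assms
\<comment> \<open>The relation varies along with \<open>V\<close>, because the smaller graph built
  below has a new adjacency; so \<open>finite_graph\<close> is a premise here instead of the ambient
  locale.\<close>
proof (induction "card V" arbitrary: E V rule: less_induct)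
  case less
  interpret finite_graph U E by fact
  note VU = \<open>V \<subseteq> U\<close> and ch = \<open>chordal_on E V\<close> and ac = \<open>Z2_acyclic U E V\<close>
    and stiff = less.prems(5)
  have finV: "finite V" using VU fin by (rule finite_subset)
  have V0: "V \<noteq> {}" using ac not_acyclic_empty by auto
  show ?case
  proof (rule ccontr)
    assume c1: "card V \<noteq> 1"
    have nonisolated: "\<exists>x\<in>V. E p x" if p: "p \<in> V" for p
    proof (rule ccontr)
      assume n: "\<not> ?thesis"
      have "V \<noteq> {p}" using c1 by auto
      then obtain q where "q \<in> V" "q \<noteq> p" using p by blast
      then have "dominated E V q p" using n p by (auto simp: dominated_def)
      then show False using stiff by blast
    qed
    define nbs where "nbs M = {x \<in> V - M. \<exists>m\<in>M. E m x}" for M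
    define clique where "clique Q \<longleftrightarrow> (\<forall>x\<in>Q. \<forall>y\<in>Q. x \<noteq> y \<longrightarrow> E x y)" for Q
    define good where
      "good M \<longleftrightarrow> M \<subseteq> V \<and> connected_in M \<and> clique (nbs M) \<and> \<not> clique (M \<union> nbs M)" for M
    \<comment> \<open>Otherwise each component, having no neighbours, is a clique and every vertex
      is simplicial; stripping them all leaves the empty graph, which is not acyclic.\<close>
    have "\<exists>M. good M"
    proof (rule ccontr)
      assume none: "\<nexists>M. good M"
      have "simplicial V b" if b: "b \<in> V" for b
      proof -
        let ?M = "component V b"
        have sub: "?M \<subseteq> V" using component_subset b by blast
        have "nbs ?M = {}" using component_closed[OF _ b] by (auto simp: nbs_def)
        then have "clique ?M"
          using none sub connected_component[of V b] by (auto simp: good_def clique_def)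
        moreover have "x \<in> ?M" if "x \<in> V" "E b x" for x
          using component_closed[of b V b x] b that by simp
        ultimately show ?thesis by (auto simp: simplicial_def clique_def)
      qed
      then have "acyc (V - (\<Union>b\<in>V. closed_nbrs E b))"
        using ac VU nonisolated by (intro acyclic_strip) auto
      moreover have "V - (\<Union>b\<in>V. closed_nbrs E b) = {}" by (auto simp: closed_nbrs_def)
      ultimately show False using not_acyclic_empty by simp
    qed
    then obtain M where M: "good M" and Mmin: "\<And>M'. good M' \<Longrightarrow> card M \<le> card M'"
      using ex_has_least_nat[of good _ card] by blast
    define R where "R = nbs M"
    have MV: "M \<subseteq> V" and Mc: "connected_in M" and Rc: "clique R" and MRc: "\<not> clique (M \<union> R)"
      using M by (auto simp: good_def R_def)
    have R: "R \<subseteq> V - M" by (auto simp: R_def nbs_def)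
    have finM: "finite M" using MV finV by (rule finite_subset)
    have finR: "finite R" using R finV finite_subset by blast
    have MR: "x \<in> M \<union> R" if "m \<in> M" "E m x" "x \<in> V" for m x
      using that by (auto simp: R_def nbs_def)
    have Rnb: "\<exists>a\<in>M. E k a" if "k \<in> R" for k
      using that sym by (auto simp: R_def nbs_def)
    obtain y0 where y0: "y0 \<in> M" "\<And>k. k \<in> R \<Longrightarrow> E y0 k"
      using chordal_complete_vertex[OF ch Mc MV R finR _ Rnb] Rc unfolding clique_def by blast
    obtain P where P: "insert y0 R \<subseteq> P" "P \<subseteq> V" "\<And>x y. x \<in> P \<Longrightarrow> y \<in> P \<Longrightarrow> x \<noteq> y \<Longrightarrow> E x y"
      "\<And>a. a \<in> V \<Longrightarrow> a \<notin> P \<Longrightarrow> \<exists>u\<in>P. \<not> E u a"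
    proof (rule exists_maximal_clique[of V "insert y0 R"])
      show "insert y0 R \<subseteq> V" using y0 MV R by auto
      show "E x y" if "x \<in> insert y0 R" "y \<in> insert y0 R" "x \<noteq> y" for x y
        using that y0 Rc sym by (auto simp: clique_def)
    qed (use finV in auto)
    have PMR: "P \<subseteq> M \<union> R"
    proof
      fix x assume "x \<in> P"
      then show "x \<in> M \<union> R" using MR[OF y0(1), of x] y0(1) P(1-3) by (cases "x = y0") auto
    qed
    define B where "B = M - P"
    define C where "C = V - M - R"
    have BM: "B \<subseteq> M" and BV: "B \<subseteq> V" and CV: "C \<subseteq> V" using MV by (auto simp: B_def C_def)
    have CM: "\<not> E c m" if "c \<in> C" "m \<in> M" for c m
      using MR[OF that(2), of c] that(1) sym by (auto simp: C_def)
    have CcnbM: "C \<inter> closed_nbrs E m = {}" if m: "m \<in> M" for m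
    proof -
      have "x \<noteq> m \<and> \<not> E m x" if x: "x \<in> C" for x
        using CM[OF x m] sym x m by (auto simp: C_def)
      then show ?thesis unfolding closed_nbrs_def by blast
    qed
    have Vsplit: "V = C \<union> P \<union> B" using P(2) PMR P(1) MV by (auto simp: B_def C_def)
    have CR: "x \<in> C \<union> R" if "c \<in> C" "E c x" "x \<in> V" for c x
      using CM[OF that(1), of x] that by (auto simp: C_def)
    have B0: "B \<noteq> {}"
    proof
      assume "B = {}"
      then have "M \<union> R \<subseteq> P" using P(1) by (auto simp: B_def)
      then show False using MRc P(3) by (auto simp: clique_def)
    qed
    \<comment> \<open>A component \<open>A\<close> of \<open>B\<close> has its neighbours in the
      clique \<open>P\<close> and is smaller than \<open>M\<close>, since it misses
      \<open>y0\<close>. Minimality of \<open>M\<close> makes \<open>A\<close> with its neighbours a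
      clique. A walk in \<open>M\<close> from \<open>a\<close> to \<open>y0\<close> leaves
      \<open>A\<close> through a vertex of \<open>P\<close>.\<close>
    have B1: "simplicial V a \<and> (\<exists>y\<in>M \<inter> P. E a y)" if a: "a \<in> B" for a
    proof -
      define A where "A = component B a"
      have A: "A \<subseteq> B" "connected_in A" "a \<in> A"
        unfolding A_def using component_subset[OF a] connected_component by auto
      have nA: "nbs A \<subseteq> P"
      proof
        fix x assume "x \<in> nbs A"
        then obtain m where x: "x \<in> V" "x \<notin> A" "m \<in> A" "E m x" by (auto simp: nbs_def)
        then have "x \<notin> B" using component_closed[of m B a x] a unfolding A_def by blast
        then show "x \<in> P" using MR[of m x] x A(1) BM P(1) by (auto simp: B_def)
      qed
      have "clique (nbs A)" using nA P(3) by (auto simp: clique_def)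
      moreover have "card A < card M"
        using A(1) BM y0(1) P(1) finM by (intro psubset_card_mono) (auto simp: B_def)
      then have "\<not> good A" using Mmin[of A] by auto
      ultimately have Ac: "clique (A \<union> nbs A)" using A BV by (auto simp: good_def)
      have in_A: "x \<in> A \<union> nbs A" if "x \<in> V" "E a x" for x
        using that A(3) by (auto simp: nbs_def)
      have "simplicial V a" using in_A Ac by (auto simp: simplicial_def clique_def)
      moreover have "\<exists>y\<in>M \<inter> P. E a y"
      proof -
        have "(adj_in M)\<^sup>*\<^sup>* a y0" using Mc A BM y0(1) by (auto simp: connected_in_def)
        moreover have "y0 \<notin> A" using A(1) P(1) by (auto simp: B_def)
        ultimately have "\<exists>u v. u \<in> A \<and> v \<notin> A \<and> adj_in M u v"
          using A(3)
        proof (induction rule: converse_rtranclp_induct)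
          case (step u v) then show ?case by (cases "v \<in> A") auto
        qed auto
        then obtain u v where uv: "u \<in> A" "v \<notin> A" "v \<in> M" "E u v" by (auto simp: adj_in_def)
        then have "v \<in> nbs A" using MV by (auto simp: nbs_def)
        moreover have "a \<noteq> v" using uv A(3) by auto
        ultimately have "v \<in> M \<inter> P" "E a v" using nA uv Ac A(3) by (auto simp: clique_def)
        then show ?thesis by blast
      qed
      ultimately show ?thesis by blast
    qed
    \<comment> \<open>With all its neighbours in \<open>P\<close>, the vertex \<open>a\<close> would
      dominate a vertex \<open>u\<close> of \<open>P\<close> not adjacent to it, and such a
      \<open>u\<close> exists by maximality of \<open>P\<close>.\<close>
    have B2: "\<exists>b\<in>B. E a b" if a: "a \<in> B" for a
    proof (rule ccontr)
      assume n: "\<not> ?thesis"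
      have aV: "a \<in> V" "a \<notin> P" using a BV by (auto simp: B_def)
      then obtain u where u: "u \<in> P" "\<not> E u a" using P(4) by blast
      have "E u x" if "x \<in> V" "E a x" for x
      proof -
        have "x \<in> P" using MR[of a x] that a BM n P(1) by (auto simp: B_def)
        moreover have "u \<noteq> x" using u that sym by blast
        ultimately show ?thesis using P(3) u by blast
      qed
      then have "dominated E V u a" using u aV P(2) by (auto simp: dominated_def)
      then show False using stiff by blast
    qed
    \<comment> \<open>After passing to the link of \<open>z\<close>, justified by the simplicial
      neighbour \<open>a\<close>, the rest of \<open>B\<close> is stripped. The clique
      \<open>P\<close> disappears with N[z], and stripping leaves \<open>C\<close> alone, which has
      no edges to \<open>M\<close>.\<close>
    have link: "acyc (C - closed_nbrs E z)" if z: "z \<in> P" and a: "a \<in> B" "E a z" for z a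
    proof -
      let ?V = "V - closed_nbrs E z" and ?B = "B - closed_nbrs E z"
      have "acyc ?V"
        using ac VU a z BV P(2) B1[OF a(1)]
        by (intro acyclic_link_if_dominating_neighbour[of V a]) (auto intro: simplicial_closed_nbrs)
      then have "acyc (?V - (\<Union>b\<in>?B. closed_nbrs E b))"
      proof (rule acyclic_strip)
        show "simplicial ?V b" if "b \<in> ?B" for b
          using that B1[of b] by (auto simp: simplicial_def)
        show "\<exists>b'\<in>?B. E b b'" if b: "b \<in> ?B" for b
        proof -
          obtain b' where b': "b' \<in> B" "E b b'" using B2 b by blast
          have "b' \<notin> closed_nbrs E z"
          proof
            assume "b' \<in> closed_nbrs E z"
            then have "E b' z" using b b' z sym by (auto simp: closed_nbrs_def B_def)
            then have "b \<in> closed_nbrs E z"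
              using simplicial_closed_nbrs[of V b' z b] B1[OF b'(1)] z P(2) b b' BV sym by blast
            then show False using b by blast
          qed
          then show ?thesis using b' by blast
        qed
      qed (use VU BV in auto)
      moreover have "?V - (\<Union>b\<in>?B. closed_nbrs E b) = C - closed_nbrs E z"
      proof -
        have "P \<subseteq> closed_nbrs E z" using P(3) z by (auto simp: closed_nbrs_def)
        moreover have "C \<inter> closed_nbrs E b = {}" if "b \<in> B" for b
          using that CcnbM BM by blast
        moreover have "b \<in> closed_nbrs E b" for b by (simp add: closed_nbrs_def)
        ultimately show ?thesis using Vsplit CV by blast
      qed
      ultimately show ?thesis by simp
    qed
    obtain a y where a: "a \<in> B" "y \<in> M \<inter> P" "E a y" using B0 B1 by blast
    \<comment> \<open>A vertex of \<open>M\<close> has no neighbours in \<open>C\<close>, so at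
      \<open>z = y\<close> the fact \<open>link\<close> is about \<open>C\<close> itself.\<close>
    have acC: "acyc C"
    proof -
      have "C \<inter> closed_nbrs E y = {}" using a CcnbM by blast
      then show ?thesis using link[of y a] a by (simp add: Diff_triv)
    qed
    \<comment> \<open>What stripping all of \<open>B\<close> leaves of \<open>P\<close>: the
      vertices of \<open>P\<close> to which \<open>link\<close> does not apply.\<close>
    define Z where "Z = P - (\<Union>b\<in>B. closed_nbrs E b)"
    have acCZ: "acyc (C \<union> Z)"
    proof -
      have "acyc (V - (\<Union>b\<in>B. closed_nbrs E b))"
        using ac VU BV B1 B2 by (intro acyclic_strip) auto
      moreover have "V - (\<Union>b\<in>B. closed_nbrs E b) = C \<union> Z"
      proof -
        have "C \<inter> closed_nbrs E b = {}" if "b \<in> B" for b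
          using that CcnbM BM by blast
        moreover have "b \<in> closed_nbrs E b" for b by (simp add: closed_nbrs_def)
        ultimately show ?thesis unfolding Z_def Vsplit by blast
      qed
      ultimately show ?thesis by simp
    qed
    have linkR: "acyc (C - closed_nbrs E z)" if z: "z \<in> R" for z
    proof (cases "\<exists>b\<in>B. E b z")
      case True
      then show ?thesis using link z P(1) by blast
    next
      case False
      have zP: "z \<in> P" using z P(1) by blast
      then have "z \<in> Z" using False unfolding Z_def closed_nbrs_def B_def by blast
      moreover have "C \<union> Z \<subseteq> U" using CV P(2) VU by (auto simp: Z_def)
      moreover have "z \<notin> C" using z by (simp add: C_def)
      ultimately show ?thesis
        using acC acCZ P(3) by (intro acyclic_link_if_clique[of C Z z]) (auto simp: Z_def)
    qed
    obtain b where b: "b \<in> B" "E a b" using B2 a by blast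
    have ab: "a \<noteq> b" "a \<notin> C \<union> R" "b \<notin> C \<union> R"
      using a b irrefl BM R by (auto simp: C_def)
    \<comment> \<open>\<open>a\<close> and \<open>b\<close> are recycled as the two new vertices:
      their old adjacencies are discarded, and they are joined to each other and to all of
      \<open>R\<close> only. The new graph thus stays inside \<open>V\<close>, and it is smaller
      because \<open>y\<close> is dropped.\<close>
    define E' where "E' x y = (if x \<in> {a, b} \<or> y \<in> {a, b}
      then x \<noteq> y \<and> x \<in> R \<union> {a, b} \<and> y \<in> R \<union> {a, b} else E x y)" for x y
    define W where "W = C \<union> R \<union> {a, b}"
    interpret G': finite_graph U E'
      by unfold_locales (auto simp: E'_def fin sym irrefl)
    have WV: "W \<subseteq> V" using CV R a b BV by (auto simp: W_def)
    have "y \<in> V - W" using a b MV R by (auto simp: W_def C_def B_def)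
    then have "card W < card V" using WV finV by (intro psubset_card_mono) auto
    moreover have "finite_graph U E'" ..
    moreover have EE: "E' x y = E x y" if "x \<in> C \<union> R" "y \<in> C \<union> R" for x y
      using that ab by (auto simp: E'_def)
    have sims: "G'.simplicial W a" "G'.simplicial W b"
      using Rc ab unfolding G'.simplicial_def E'_def clique_def by auto
    have "chordal_on E' W"
    proof -
      have "chordal_on E (C \<union> R)" using ch CV R chordal_on_mono[of E V "C \<union> R"] by blast
      then have "chordal_on E' (C \<union> R)"
        unfolding chordal_on_def using EE by (smt (verit, best) nth_mem subset_iff)
      moreover have "W - {a} - {b} = C \<union> R" using ab by (auto simp: W_def)
      moreover have "G'.simplicial (W - {a}) b" using sims by (auto simp: G'.simplicial_def)
      ultimately show ?thesis
        using G'.chordal_on_if_simplicial sims by metis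
    qed
    moreover have "Z2_acyclic U E' W"
    proof (rule G'.acyclic_if_simplicial)
      show "W \<subseteq> U" "a \<in> W" using WV VU by (auto simp: W_def)
      show "G'.simplicial W a" by fact
      fix w assume w: "w \<in> W" "E' a w"
      then have wR: "w \<in> R \<union> {b}" by (auto simp: E'_def)
      show "Z2_acyclic U E' (W - closed_nbrs E' w)"
      proof (cases "w = b")
        case True
        have "W - closed_nbrs E' w = C" using True ab R by (auto simp: W_def closed_nbrs_def E'_def C_def)
        moreover have "Z2_acyclic U E' C \<longleftrightarrow> acyc C" by (rule Z2_acyclic_cong) (simp add: EE)
        ultimately show ?thesis using acC by simp
      next
        case False
        then have wR: "w \<in> R" using wR by blast
        have "W - closed_nbrs E' w = C - closed_nbrs E w"
          using wR ab Rc by (auto simp: W_def closed_nbrs_def E'_def clique_def)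
        moreover have "Z2_acyclic U E' (C - closed_nbrs E w) \<longleftrightarrow> acyc (C - closed_nbrs E w)"
          by (rule Z2_acyclic_cong) (simp add: EE)
        ultimately show ?thesis using linkR[OF wR] by simp
      qed
    qed
    \<comment> \<open>A vertex \<open>u'\<close> of the clique \<open>R \<union> {a, b}\<close> is
      adjacent to \<open>a\<close> or \<open>b\<close>, which puts \<open>u\<close> into the same
      clique, although a dominated vertex is not adjacent to its dominator. If \<open>u'\<close>
      lies in \<open>C\<close>, a domination already occurs in \<open>V\<close>, with
      \<open>y0\<close> standing in for \<open>a\<close> or \<open>b\<close>.\<close>
    moreover have "\<not> dominated E' W u u'" for u u'
    proof
      assume "dominated E' W u u'"
      then have d: "u \<in> W" "u' \<in> W" "u \<noteq> u'" "\<And>x. x \<in> W \<Longrightarrow> E' u' x \<Longrightarrow> E' u x"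
        by (auto simp: dominated_def)
      have ua: "\<not> E' u' u" using d(4)[OF d(1)] G'.irrefl by blast
      show False
      proof (cases "u' \<in> C")
        case False
        then have u': "u' \<in> R \<union> {a, b}" using d(2) by (auto simp: W_def)
        have adj: "E' u' x" if "x \<in> R \<union> {a, b}" "x \<noteq> u'" for x
          using that u' Rc by (auto simp: E'_def clique_def)
        obtain x where x: "x \<in> {a, b}" "x \<noteq> u'" using ab(1) by blast
        then have "E' u x" using adj[of x] d(4)[of x] by (auto simp: W_def)
        then have "u \<in> R \<union> {a, b}" using x by (auto simp: E'_def)
        then show False using adj[of u] d(3) ua by blast
      next
        case u'C: True
        have u'V: "u' \<in> V" using u'C CV by blast
        show False
        proof (cases "u \<in> {a, b}")
          case True
          have "E y0 x" if x: "x \<in> V" "E u' x" for x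
          proof -
            have xCR: "x \<in> C \<union> R" using CR u'C x by blast
            then have "E' u x" using d(4)[of x] EE[of u' x] u'C x by (auto simp: W_def)
            then have "x \<in> R" using True xCR ab by (auto simp: E'_def)
            then show ?thesis using y0 by blast
          qed
          then have "dominated E V y0 u'"
            using u'V y0(1) MV u'C by (auto simp: dominated_def C_def)
          then show False using stiff by blast
        next
          case False
          then have uCR: "u \<in> C \<union> R" using d(1) by (auto simp: W_def)
          have "E u x" if x: "x \<in> V" "E u' x" for x
          proof -
            have xCR: "x \<in> C \<union> R" using CR u'C x by blast
            then have "E' u x" using d(4)[of x] EE[of u' x] u'C x by (auto simp: W_def)
            then show ?thesis using EE[OF uCR xCR] by simp
          qed
          then have "dominated E V u u'"
            using u'V uCR CV R d(3) by (auto simp: dominated_def)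
          then show False using stiff by blast
        qed
      qed
    qed
    ultimately have "card W = 1" using less.hyps[of W E'] WV VU by blast
    moreover have "card {a, b} \<le> card W"
      using WV finV by (intro card_mono) (auto simp: W_def intro: finite_subset)
    ultimately show False using ab(1) by simp
  qed
qed

section \<open>Dismantlability and geometric realizations\<close>

text \<open>The common form of both notions of dismantlability, which reduces their equivalence to
  the agreement of the two dominations.\<close>

inductive dismantles :: "('a \<Rightarrow> 'a \<Rightarrow> bool) \<Rightarrow> 'a set \<Rightarrow> bool" for E where
  single: "dismantles E {v}"
| step: "dominated E V u u' \<Longrightarrow> dismantles E (V - {u}) \<Longrightarrow> dismantles E V"

definition cograph :: "('a \<Rightarrow> 'a \<Rightarrow> bool) \<Rightarrow> 'a set \<Rightarrow> 'a graph" where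
  "cograph E V = Graph V {{u, v} | u v. u \<in> V \<and> v \<in> V \<and> u \<noteq> v \<and> \<not> E u v}"

lemma deletion_indep: "deletion (indep E V) u = indep E (V - {u})"
  by (auto simp: deletion_def indep_def)

lemma delete_vertex_cograph: "delete_vertex (cograph E V) u = cograph E (V - {u})"
  by (auto simp: delete_vertex_def cograph_def)

lemma cograph_eq_single: "cograph E V = Graph {v} {} \<longleftrightarrow> V = {v}"
  by (auto simp: cograph_def)

section \<open>Realizations in barycentric coordinates\<close>

lemma topspace_realization_indep:
  assumes "finite V"
  shows "topspace (realization (indep E V)) =
    {x. (\<forall>v. 0 \<le> x v) \<and> {v. x v \<noteq> 0} \<in> indep E V \<and> (\<Sum>v\<in>V. x v) = 1}"
proof -
  have "(\<Sum>v | x v \<noteq> 0. x v) = (\<Sum>v\<in>V. x v)" if "{v. x v \<noteq> 0} \<in> indep E V" for x :: "'a \<Rightarrow> real"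
    using that assms by (intro sum.mono_neutral_left) (auto simp: indep_def)
  then show ?thesis by (auto simp: realization_def)
qed

lemma continuous_map_realization_apply:
  "continuous_map (realization K) euclideanreal (\<lambda>x. x v)"
  unfolding realization_def
  by (blast intro: continuous_map_from_subtopology[OF continuous_map_product_projection])

lemma continuous_map_into_realization:
  assumes "\<And>v. continuous_map X euclideanreal (\<lambda>x. f x v)"
    "\<And>x. x \<in> topspace X \<Longrightarrow> f x \<in> topspace (realization K)"
  shows "continuous_map X (realization K) f"
  using assms unfolding realization_def continuous_map_in_subtopology
  by (auto simp: continuous_map_componentwise_UNIV)

context finite_graph
begin

lemma indep_eq_single: "indep E V = {{}, {v}} \<longleftrightarrow> V = {v}"
proof
  assume eq: "indep E V = {{}, {v}}"
  have "x \<in> V \<longleftrightarrow> {x} \<in> indep E V" for x by (auto simp: indep_def irrefl)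
  then show "V = {v}" unfolding eq by auto
qed (auto simp: indep_def irrefl)

text \<open>Independence is a condition on pairs, so the cone condition on the link need only be
  tested on single vertices: whatever is not adjacent to \<open>u\<close> must not be adjacent to
  \<open>u'\<close>.\<close>

lemma complex_dominated_indep:
  "complex_dominated (indep E V) u u' \<longleftrightarrow> dominated E V u u'"
proof
  assume a: "complex_dominated (indep E V) u u'"
  then have uV: "u \<in> V" "u' \<in> V" "u' \<noteq> u"
    and apex: "cone_with_apex (link (indep E V) u) u'"
    by (auto simp: complex_dominated_def indep_def)
  have "E u x" if "x \<in> V" "E u' x" for x
  proof (rule ccontr)
    assume n: "\<not> E u x"
    have "x \<noteq> u"
    proof
      assume "x = u"
      moreover have "{u'} \<in> link (indep E V) u" using apex by (simp add: cone_with_apex_def)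
      ultimately show False using \<open>E u' x\<close> by (auto simp: link_def indep_def)
    qed
    moreover have "\<not> E x u" using n sym by blast
    ultimately have "{x} \<in> link (indep E V) u"
      using that uV n irrefl by (auto simp: link_def indep_def)
    then have "{u', x} \<in> link (indep E V) u" using apex by (simp add: cone_with_apex_def)
    then show False using \<open>E u' x\<close> by (auto simp: link_def indep_def)
  qed
  then show "dominated E V u u'" using uV by (auto simp: dominated_def)
next
  assume d: "dominated E V u u'"
  then have uV: "u \<in> V" "u' \<in> V" "u' \<noteq> u" and dom: "\<And>x. x \<in> V \<Longrightarrow> E u' x \<Longrightarrow> E u x"
    by (auto simp: dominated_def)
  have n: "\<not> E u' u" "\<not> E u u'" using dom[OF uV(1)] irrefl sym by blast+
  have "insert u' s \<in> link (indep E V) u" if s: "s \<in> link (indep E V) u" for s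
  proof -
    have s': "u \<notin> s" "s \<subseteq> V" "\<forall>x\<in>insert u s. \<forall>y\<in>insert u s. \<not> E x y"
      using s by (auto simp: link_def indep_def)
    have "\<not> E u' x" "\<not> E x u'" if "x \<in> s" for x
      using dom[of x] s' that sym by blast+
    then show ?thesis using s' uV n irrefl by (auto simp: link_def indep_def)
  qed
  moreover have "{u'} \<in> link (indep E V) u" using uV n irrefl by (auto simp: link_def indep_def)
  ultimately show "complex_dominated (indep E V) u u'"
    using uV irrefl by (auto simp: complex_dominated_def cone_with_apex_def indep_def)
qed

lemma graph_dominated_cograph:
  "graph_dominated (cograph E V) u u' \<longleftrightarrow> dominated E V u u'"
proof -
  have "closed_nbhd (cograph E V) w = {v \<in> V. \<not> E w v}" if "w \<in> V" for w
    using that irrefl sym by (auto simp: closed_nbhd_def cograph_def doubleton_eq_iff)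
  then show ?thesis by (auto simp: graph_dominated_def dominated_def cograph_def)
qed

lemma complex_dismantlable_iff: "complex_dismantlable (indep E V) \<longleftrightarrow> dismantles E V"
proof
  assume "complex_dismantlable (indep E V)"
  then obtain v where "complex_dismantling_step\<^sup>*\<^sup>* (indep E V) {{}, {v}}"
    by (auto simp: complex_dismantlable_def)
  then show "dismantles E V"
  proof (induction "indep E V" arbitrary: V rule: converse_rtranclp_induct)
    case base
    then show ?case using indep_eq_single[of V v] by (metis dismantles.single)
  next
    case (step K)
    then obtain u u' where u: "dominated E V u u'" "K = indep E (V - {u})"
      by (auto simp: complex_dismantling_step_def complex_dominated_indep deletion_indep)
    then show ?case by (intro dismantles.step[OF u(1)] step.hyps(3))
  qed
next
  assume "dismantles E V"
  then show "complex_dismantlable (indep E V)"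
  proof induction
    case (single v)
    have "indep E {v} = {{}, {v}}" using indep_eq_single by blast
    then show ?case by (auto simp: complex_dismantlable_def)
  next
    case (step V u u')
    then have "complex_dismantling_step (indep E V) (indep E (V - {u}))"
      by (auto simp: complex_dismantling_step_def complex_dominated_indep deletion_indep)
    then show ?case
      using step.IH by (auto simp: complex_dismantlable_def intro: converse_rtranclp_into_rtranclp)
  qed
qed

lemma graph_dismantlable_iff: "graph_dismantlable (cograph E V) \<longleftrightarrow> dismantles E V"
proof
  assume "graph_dismantlable (cograph E V)"
  then obtain v where "graph_dismantling_step\<^sup>*\<^sup>* (cograph E V) (Graph {v} {})"
    by (auto simp: graph_dismantlable_def)
  then show "dismantles E V"
  proof (induction "cograph E V" arbitrary: V rule: converse_rtranclp_induct)
    case base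
    then show ?case using cograph_eq_single[of E V v] by (metis dismantles.single)
  next
    case (step K)
    then obtain u u' where u: "dominated E V u u'" "K = cograph E (V - {u})"
      by (auto simp: graph_dismantling_step_def graph_dominated_cograph delete_vertex_cograph)
    then show ?case by (intro dismantles.step[OF u(1)] step.hyps(3))
  qed
next
  assume "dismantles E V"
  then show "graph_dismantlable (cograph E V)"
  proof induction
    case (single v)
    have "cograph E {v} = Graph {v} {}" by (simp add: cograph_eq_single)
    then show ?case by (auto simp: graph_dismantlable_def)
  next
    case (step V u u')
    then have "graph_dismantling_step (cograph E V) (cograph E (V - {u}))"
      by (auto simp: graph_dismantling_step_def graph_dominated_cograph delete_vertex_cograph)
    then show ?case
      using step.IH by (auto simp: graph_dismantlable_def intro: converse_rtranclp_into_rtranclp)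
  qed
qed

text \<open>The weight at \<open>u\<close> is slid onto \<open>u'\<close>, which can be added to any
  face through \<open>u\<close>. This deforms the identity to \<open>h 1\<close>, whose image lies
  in the contractible deletion, so the identity is nullhomotopic.\<close>

lemma contractible_dominated:
  assumes "finite V" "dominated E V u u'" "complex_contractible (indep E (V - {u}))"
  shows "complex_contractible (indep E V)"
proof -
  let ?X = "realization (indep E V)" and ?Y = "realization (indep E (V - {u}))"
  have uV: "u \<in> V" "u' \<in> V" "u \<noteq> u'" and dom: "\<And>x. x \<in> V \<Longrightarrow> E u' x \<Longrightarrow> E u x"
    using assms(2) by (auto simp: dominated_def)
  note X = topspace_realization_indep[OF assms(1), of E]
  have fin': "finite (V - {u})" using assms(1) by simp
  note Y = topspace_realization_indep[OF fin', of E]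
  define h where "h t x v = x v + t * x u * ((if v = u' then 1 else 0) - (if v = u then 1 else 0))"
    for t :: real and x :: "'a \<Rightarrow> real" and v
  have h_in: "h t x \<in> topspace ?X" if "x \<in> topspace ?X" "0 \<le> t" "t \<le> 1" for t x
  proof -
    have x: "\<And>v. 0 \<le> x v" "{v. x v \<noteq> 0} \<in> indep E V" "(\<Sum>v\<in>V. x v) = 1"
      using that(1) unfolding X by auto
    have "t * x u \<le> 1 * x u" using that x by (intro mult_right_mono) auto
    then have "0 \<le> h t x v" for v
      using that x uV by (auto simp: h_def)
    moreover have "{v. h t x v \<noteq> 0} \<in> indep E V"
    proof (cases "x u = 0")
      case True
      then show ?thesis using x by (simp add: h_def)
    next
      case False
      have ind: "\<not> E a b" if "x a \<noteq> 0" "x b \<noteq> 0" for a b using x(2) that by (auto simp: indep_def)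
      have ind': "\<not> E u' a" "\<not> E a u'" if "x a \<noteq> 0" for a
        using dom[of a] ind[OF False that] x(2) that sym by (auto simp: indep_def)
      have "{v. h t x v \<noteq> 0} \<subseteq> insert u' {v. x v \<noteq> 0}"
        using False by (auto simp: h_def split: if_splits)
      moreover have "insert u' {v. x v \<noteq> 0} \<in> indep E V"
        using x(2) uV ind ind' irrefl by (auto simp: indep_def)
      ultimately show ?thesis unfolding indep_def by blast
    qed
    moreover have "(\<Sum>v\<in>V. h t x v) = 1"
      using uV assms(1) x(3)
      by (simp add: h_def sum.distrib sum_subtractf flip: sum_distrib_left)
    ultimately show ?thesis unfolding X by simp
  qed
  have YX: "topspace ?Y \<subseteq> topspace ?X"
  proof
    fix x assume "x \<in> topspace ?Y"
    then have x: "\<And>v. 0 \<le> x v" "{v. x v \<noteq> 0} \<in> indep E (V - {u})" "(\<Sum>v\<in>V - {u}. x v) = 1"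
      unfolding Y by auto
    have "x u = 0" using x(2) by (auto simp: indep_def)
    then have "(\<Sum>v\<in>V. x v) = 1" using x(3) uV assms(1) by (simp add: sum.remove[of V u])
    then show "x \<in> topspace ?X" using x unfolding X by (auto simp: indep_def)
  qed
  have h1: "h 1 x \<in> topspace ?Y" if "x \<in> topspace ?X" for x
  proof -
    have "h 1 x \<in> topspace ?X" using h_in that by simp
    then have x: "\<And>v. 0 \<le> h 1 x v" "{v. h 1 x v \<noteq> 0} \<in> indep E V" "(\<Sum>v\<in>V. h 1 x v) = 1"
      unfolding X by auto
    have hu: "h 1 x u = 0" using uV by (simp add: h_def)
    then have "(\<Sum>v\<in>V - {u}. h 1 x v) = 1" using x(3) uV assms(1) by (simp add: sum.remove[of V u])
    then show ?thesis using x hu unfolding Y by (auto simp: indep_def)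
  qed
  have cont1: "continuous_map ?X ?Y (h 1)"
    using h1 unfolding h_def
    by (intro continuous_map_into_realization continuous_intros continuous_map_realization_apply) auto
  have incl: "continuous_map ?Y ?X id"
    using YX by (intro continuous_map_into_realization) (auto intro: continuous_map_realization_apply)
  obtain c where c: "homotopic_with (\<lambda>h. True) ?X ?X (h 1) (\<lambda>x. c)"
    using nullhomotopic_through_contractible_space[OF cont1 incl] assms(3)
    by (auto simp: complex_contractible_def)
  have "homotopic_with (\<lambda>h. True) ?X ?X id (h 1)"
  proof -
    let ?T = "prod_topology (top_of_set {0..1}) ?X"
    have t: "continuous_map ?T euclideanreal fst"
      using continuous_map_fst continuous_map_into_fulltopology by blast
    have x: "continuous_map ?T euclideanreal (\<lambda>p. snd p v)" for v
      using continuous_map_compose[OF continuous_map_snd continuous_map_realization_apply]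
      by (simp add: o_def)
    have "continuous_map ?T ?X (\<lambda>p. h (fst p) (snd p))"
    proof (rule continuous_map_into_realization)
      show "continuous_map ?T euclideanreal (\<lambda>p. h (fst p) (snd p) v)" for v
        unfolding h_def by (intro continuous_intros t x)
    qed (use h_in in auto)
    then show ?thesis
      unfolding homotopic_with_def
      by (intro exI[of _ "\<lambda>p. h (fst p) (snd p)"]) (auto simp: h_def)
  qed
  then have "homotopic_with (\<lambda>h. True) ?X ?X id (\<lambda>x. c)"
    using c homotopic_with_trans by blast
  then have "contractible_space ?X" by (auto simp: contractible_space_def)
  moreover have "topspace ?X \<noteq> {}" using assms(3) YX by (auto simp: complex_contractible_def)
  ultimately show ?thesis by (simp add: complex_contractible_def)
qed

lemma dismantles_imp_contractible:
  assumes "dismantles E V" "finite V"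
  shows "complex_contractible (indep E V)"
  using assms
proof induction
  case (single v)
  let ?e = "\<lambda>x. if x = v then 1 else 0 :: real"
  have eq: "topspace (realization (indep E {v})) = {?e}"
    by (subst topspace_realization_indep) (auto simp: indep_def irrefl fun_eq_iff split: if_splits)
  show ?case
    using contractible_space_subset_singleton[of "realization (indep E {v})" ?e] eq
    by (auto simp: complex_contractible_def)
next
  case (step V u u')
  then show ?case using contractible_dominated by blast
qed

text \<open>The sphere is a retract: \<open>f\<close> takes the normalized signed weights over the
  pairs of poles, and \<open>k\<close> is a right inverse through the embedded cross-polytope.
  \<open>nsphere n\<close> has the coordinates 0 to \<open>n\<close>, so \<open>d = Suc n\<close>;
  for \<open>d = 0\<close> the realization is empty.\<close>

lemma sphere_cert_not_contractible:
  assumes "finite V" "sphere_cert E V d"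
  shows "\<not> complex_contractible (indep E V)"
proof (cases d)
  case 0
  then have "V = {}" using assms(2) by (auto simp: sphere_cert_def)
  then show ?thesis using topspace_realization_indep[of V E] by (simp add: complex_contractible_def)
next
  case (Suc n)
  let ?X = "realization (indep E V)"
  note X = topspace_realization_indep[OF assms(1), of E]
  obtain idx sg pt where idx: "\<forall>u\<in>V. idx u < Suc n"
    and opp: "\<forall>u\<in>V. \<forall>u'\<in>V. idx u = idx u' \<and> sg u \<noteq> sg u' \<longrightarrow> E u u'"
    and pt: "\<forall>i<Suc n. \<forall>b. pt i b \<in> V \<and> idx (pt i b) = i \<and> sg (pt i b) = (b::bool)"
    and nadj: "\<forall>i<Suc n. \<forall>j<Suc n. \<forall>b b'. i \<noteq> j \<longrightarrow> \<not> E (pt i b) (pt j b')"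
    using assms(2) unfolding sphere_cert_def Suc by (elim exE conjE) (rule that)
  define g where "g x i = (\<Sum>u\<in>{u\<in>V. idx u = i}. if sg u then x u else - x u)"
    for x :: "'a \<Rightarrow> real" and i
  define f where "f x i = (if i \<le> n then g x i / sqrt (\<Sum>j\<le>n. (g x j)\<^sup>2) else 0)"
    for x :: "'a \<Rightarrow> real" and i
  define T where "T y = (\<Sum>j\<le>n. \<bar>y j\<bar>)" for y :: "nat \<Rightarrow> real"
  \<comment> \<open>Radial projection onto the cross-polytope: \<open>T\<close> is the l1 norm, and
    the weight \<open>\<bar>y i\<bar> / T y\<close> sits at \<open>pt i True\<close> or
    \<open>pt i False\<close> according to the sign of \<open>y i\<close>.\<close>
  define k where "k y u = (if u \<in> V \<and> u = pt (idx u) (sg u)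
    then max 0 (if sg u then y (idx u) else - y (idx u)) / T y else 0)"
    for y :: "nat \<Rightarrow> real" and u
  \<comment> \<open>Nothing cancels in \<open>g\<close>: vertices of one face with equal index have
    equal sign, since opposite signs would make them adjacent.\<close>
  have gpos: "0 < (\<Sum>j\<le>n. (g x j)\<^sup>2)" if "x \<in> topspace ?X" for x
  proof -
    have x: "\<And>v. 0 \<le> x v" "{v. x v \<noteq> 0} \<in> indep E V" "(\<Sum>v\<in>V. x v) = 1"
      using that unfolding X by auto
    obtain u where u: "u \<in> V" "x u \<noteq> 0" using x(3) by (metis sum.neutral zero_neq_one)
    let ?I = "{v\<in>V. idx v = idx u}"
    have same: "sg v = sg u" if "v \<in> ?I" "x v \<noteq> 0" for v
    proof (rule ccontr)
      assume "sg v \<noteq> sg u"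
      then have "E v u" using opp that u by blast
      then show False using x(2) that u by (auto simp: indep_def)
    qed
    have "g x (idx u) = (\<Sum>v\<in>?I. if sg u then x v else - x v)"
      unfolding g_def using same by (intro sum.cong) auto
    then have "\<bar>g x (idx u)\<bar> = (\<Sum>v\<in>?I. x v)"
      using x(1) by (cases "sg u") (auto simp: sum_negf sum_nonneg)
    moreover have "x u \<le> (\<Sum>v\<in>?I. x v)"
      using u x(1) assms(1) by (intro member_le_sum) auto
    moreover have "0 < x u" using u x(1)[of u] by simp
    ultimately have "g x (idx u) \<noteq> 0" by auto
    moreover have "idx u \<le> n" using idx u(1) by auto
    ultimately show ?thesis by (intro sum_pos2[of _ "idx u"]) auto
  qed
  have contg: "continuous_map ?X euclideanreal (\<lambda>x. g x i)" for i
  proof -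
    have "continuous_map ?X euclideanreal (\<lambda>x. if sg u then x u else - x u)" for u
      by (cases "sg u") (auto intro!: continuous_intros continuous_map_realization_apply)
    then show ?thesis unfolding g_def using assms(1) by (intro continuous_map_sum) auto
  qed
  have contf: "continuous_map ?X (nsphere n) f"
    unfolding nsphere continuous_map_in_subtopology
  proof
    have "continuous_map ?X euclideanreal (\<lambda>x. f x i)" for i
      unfolding f_def using gpos
      by (cases "i \<le> n") (auto intro!: continuous_intros contg dest: gpos)
    then show "continuous_map ?X (powertop_real UNIV) f"
      by (simp add: continuous_map_componentwise_UNIV)
    show "f \<in> topspace ?X \<rightarrow> {x. (\<Sum>i\<le>n. (x i)\<^sup>2) = 1 \<and> (\<forall>i>n. x i = 0)}"
    proof
      fix x assume "x \<in> topspace ?X"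
      then have p: "0 < (\<Sum>j\<le>n. (g x j)\<^sup>2)" by (rule gpos)
      have "(\<Sum>i\<le>n. (f x i)\<^sup>2) = (\<Sum>i\<le>n. (g x i)\<^sup>2 / (\<Sum>j\<le>n. (g x j)\<^sup>2))"
        using p by (intro sum.cong) (auto simp: f_def power_divide)
      also have "\<dots> = 1" using p by (simp flip: sum_divide_distrib)
      finally show "f x \<in> {x. (\<Sum>i\<le>n. (x i)\<^sup>2) = 1 \<and> (\<forall>i>n. x i = 0)}" by (auto simp: f_def)
    qed
  qed
  have Tpos: "0 < T y" if "y \<in> topspace (nsphere n)" for y
  proof -
    have "(\<Sum>i\<le>n. (y i)\<^sup>2) = 1" using that by (simp add: nsphere)
    then obtain i where "i \<le> n" "y i \<noteq> 0"
      by (metis (no_types, lifting) atMost_iff power_zero_numeral sum.neutral zero_neq_one)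
    then show ?thesis unfolding T_def by (intro sum_pos2[of _ i]) auto
  qed
  \<comment> \<open>The factor \<open>\<phi>\<close> will be 1 for the total weight and the sign for
    \<open>g\<close>.\<close>
  have fibre: "(\<Sum>u\<in>{u\<in>V. idx u = i}. \<phi> u * k y u) =
      \<phi> (pt i True) * (max 0 (y i) / T y) + \<phi> (pt i False) * (max 0 (- y i) / T y)"
    if i: "i \<le> n" for i y and \<phi> :: "'a \<Rightarrow> real"
  proof -
    have pti: "pt i b \<in> V \<and> idx (pt i b) = i \<and> sg (pt i b) = b" for b using pt i by auto
    then have ne: "pt i True \<noteq> pt i False" by metis
    have zero: "k y u = 0" if u: "u \<in> {u\<in>V. idx u = i} - {pt i True, pt i False}" for u
    proof -
      have "u \<noteq> pt (idx u) (sg u)" using u by (cases "sg u") auto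
      then show ?thesis by (simp add: k_def)
    qed
    have "(\<Sum>u\<in>{u\<in>V. idx u = i}. \<phi> u * k y u) = (\<Sum>u\<in>{pt i True, pt i False}. \<phi> u * k y u)"
      using zero pti assms(1) by (intro sum.mono_neutral_right) auto
    also have "\<dots> = \<phi> (pt i True) * k y (pt i True) + \<phi> (pt i False) * k y (pt i False)"
      using ne by simp
    finally show ?thesis using pti by (simp add: k_def)
  qed
  have k_in: "k y \<in> topspace ?X" if y: "y \<in> topspace (nsphere n)" for y
  proof -
    have Ty: "0 < T y" using Tpos y by blast
    have "0 \<le> k y v" for v using Ty by (simp add: k_def)
    moreover have "{v. k y v \<noteq> 0} \<in> indep E V"
    proof -
      have "\<not> E u v" if uv: "k y u \<noteq> 0" "k y v \<noteq> 0" for u v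
      proof -
        have uv': "u \<in> V" "u = pt (idx u) (sg u)" "v \<in> V" "v = pt (idx v) (sg v)"
          using uv by (auto simp: k_def split: if_splits)
        show ?thesis
        \<comment> \<open>Opposite poles cannot both carry weight, since the same coordinate of
          \<open>y\<close> would be both positive and negative.\<close>
        proof (cases "idx u = idx v")
          case True
          have "max 0 (if sg u then y (idx u) else - y (idx u)) \<noteq> 0"
            "max 0 (if sg v then y (idx v) else - y (idx v)) \<noteq> 0"
            using uv by (auto simp: k_def split: if_splits)
          then have "sg u = sg v" using True by (auto split: if_splits simp: max_def)
          then have "pt (idx u) (sg u) = pt (idx v) (sg v)" using True by simp
          then have "u = v" by (rule trans[OF trans[OF uv'(2)] uv'(4)[symmetric]])
          then show ?thesis using irrefl by simp
        next
          case False
          then have "\<not> E (pt (idx u) (sg u)) (pt (idx v) (sg v))" using nadj idx uv'(1,3) by blast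
          then show ?thesis unfolding uv'(2)[symmetric] uv'(4)[symmetric] .
        qed
      qed
      moreover have "v \<in> V" if "k y v \<noteq> 0" for v using that by (auto simp: k_def split: if_splits)
      ultimately show ?thesis by (auto simp: indep_def)
    qed
    moreover have "(\<Sum>v\<in>V. k y v) = 1"
    proof -
      have "(\<Sum>v\<in>V. k y v) = (\<Sum>i\<le>n. \<Sum>u\<in>{u\<in>V. idx u = i}. k y u)"
        using idx assms(1) by (intro sum.group[symmetric]) auto
      also have "\<dots> = (\<Sum>i\<le>n. \<bar>y i\<bar> / T y)"
        using fibre[of _ "\<lambda>_. 1" y] by (intro sum.cong) (auto simp: max_def)
      also have "\<dots> = T y / T y" by (simp add: T_def flip: sum_divide_distrib)
      finally show ?thesis using Ty by simp
    qed
    ultimately show ?thesis unfolding X by simp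
  qed
  have contk: "continuous_map (nsphere n) ?X k"
  proof (rule continuous_map_into_realization)
    have p: "continuous_map (nsphere n) euclideanreal (\<lambda>y. y i)" for i
      by (rule continuous_map_nsphere_projection)
    have cT: "continuous_map (nsphere n) euclideanreal T"
      unfolding T_def by (intro continuous_intros p) auto
    have T0: "T y \<noteq> 0" if "y \<in> topspace (nsphere n)" for y using Tpos[OF that] by simp
    show "continuous_map (nsphere n) euclideanreal (\<lambda>y. k y u)" for u
      unfolding k_def
      by (cases "u \<in> V \<and> u = pt (idx u) (sg u)"; cases "sg u")
        (auto intro!: continuous_intros p cT simp: T0)
  qed (rule k_in)
  have "f (k y) = y" if y: "y \<in> topspace (nsphere n)" for y
  proof
    fix i
    have Ty: "0 < T y" using Tpos y by blast
    have y1: "(\<Sum>i\<le>n. (y i)\<^sup>2) = 1" "\<And>i. n < i \<Longrightarrow> y i = 0" using y by (auto simp: nsphere)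
    \<comment> \<open>So \<open>g (k y)\<close> is a positive multiple of the unit vector
      \<open>y\<close>, and the normalization in \<open>f\<close> recovers \<open>y\<close>.\<close>
    have gk: "g (k y) j = y j / T y" if j: "j \<le> n" for j
    proof -
      have "g (k y) j = (\<Sum>u\<in>{u\<in>V. idx u = j}. (if sg u then 1 else -1) * k y u)"
        unfolding g_def by (intro sum.cong) auto
      also have "\<dots> = max 0 (y j) / T y - max 0 (- y j) / T y"
        using fibre[OF j, of "\<lambda>u. if sg u then 1 else -1" y] pt j by auto
      also have "\<dots> = y j / T y" by (auto simp: max_def)
      finally show ?thesis .
    qed
    have "(\<Sum>j\<le>n. (g (k y) j)\<^sup>2) = (\<Sum>j\<le>n. (y j)\<^sup>2 / (T y)\<^sup>2)"
      using gk by (intro sum.cong) (auto simp: power_divide)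
    also have "\<dots> = 1 / (T y)\<^sup>2" using y1 by (simp flip: sum_divide_distrib)
    finally have "sqrt (\<Sum>j\<le>n. (g (k y) j)\<^sup>2) = 1 / T y"
      using Ty by (simp add: real_sqrt_divide)
    then show "f (k y) i = y i"
      using gk[of i] y1(2)[of i] Ty by (auto simp: f_def)
  qed
  then have "retraction_map ?X (nsphere n) f"
    using contf contk by (auto simp: retraction_map_def retraction_maps_def)
  then have "\<not> contractible_space ?X"
    using contractible_space_retraction_map_image non_contractible_space_nsphere by blast
  then show ?thesis by (simp add: complex_contractible_def)
qed

text \<open>Deleting a dominated vertex keeps the graph chordal and acyclic, so the process can only
  stop at a single vertex.\<close>

lemma acyclic_imp_dismantles:
  assumes "chordal_on E V" "V \<subseteq> U" "acyc V"
  shows "dismantles E V"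
  using assms
proof (induction "card V" arbitrary: V rule: less_induct)
  case less
  show ?case
  proof (cases "\<exists>u u'. dominated E V u u'")
    case True
    then obtain u u' where d: "dominated E V u u'" by blast
    have "finite V" using less.prems(2) fin by (rule finite_subset)
    then have "card (V - {u}) < card V" using d by (intro card_Diff1_less) (auto simp: dominated_def)
    moreover have "chordal_on E (V - {u})" using less.prems(1) chordal_on_mono by blast
    moreover have "acyc (V - {u})" using acyclic_deletion_dominated less.prems d by blast
    ultimately have "dismantles E (V - {u})" using less.prems(2) by (intro less.hyps) auto
    then show ?thesis by (rule dismantles.step[OF d])
  next
    case False
    have "card V = 1"
      using False less.prems finite_graph_axioms by (intro acyclic_undominated_singleton[of U E V]) auto
    then obtain v where "V = {v}" by (auto simp: card_1_singleton_iff)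
    then show ?thesis using dismantles.single by simp
  qed
qed

lemma contractible_imp_dismantles:
  assumes "chordal_on E V" "V \<subseteq> U" "complex_contractible (indep E V)"
  shows "dismantles E V"
proof -
  have "finite V" using assms(2) fin by (rule finite_subset)
  then have "\<not> sphere_cert E V d" for d
    using sphere_cert_not_contractible assms(3) by blast
  then show ?thesis
    using sphere_cert_if_not_acyclic acyclic_imp_dismantles assms(1,2) by blast
qed

end

theorem theorem1p1:
  fixes G :: "'a graph"
  assumes "simple_graph G" and "finite (verts G)" and "chordal G"
  shows "(complex_contractible (Ind G) \<longleftrightarrow> complex_dismantlable (Ind G)) \<and>
         (complex_dismantlable (Ind G) \<longleftrightarrow> graph_dismantlable (complement_graph G))"
proof -
  let ?V = "verts G"
  define E where "E u v \<longleftrightarrow> {u, v} \<in> edges G" for u v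
  interpret finite_graph ?V E
  proof
    fix x y
    show "finite ?V" by fact
    show "E x y \<Longrightarrow> E y x" by (simp add: E_def insert_commute)
    show "\<not> E x x" using assms(1) by (force simp: E_def simple_graph_def)
  qed
  have I: "Ind G = indep E ?V" by (simp add: Ind_def indep_def E_def)
  have H: "complement_graph G = cograph E ?V" by (simp add: complement_graph_def cograph_def E_def)
  have ch: "chordal_on E ?V"
    unfolding chordal_on_def
  proof
    assume "\<exists>c. set c \<subseteq> ?V \<and> distinct c \<and> 3 < length c \<and> (\<forall>i<length c. \<forall>j<length c.
      E (c ! i) (c ! j) \<longleftrightarrow> j = Suc i mod length c \<or> i = Suc j mod length c)"
    then obtain c where "set c \<subseteq> ?V" "distinct c" "length c > 3"
      and "\<forall>i<length c. \<forall>j<length c.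
        {c ! i, c ! j} \<in> edges G \<longleftrightarrow> j = Suc i mod length c \<or> i = Suc j mod length c"
      unfolding E_def by (elim exE conjE) (rule that)
    then have "induced_cycle G c \<and> length c > 3"
      unfolding induced_cycle_def by simp
    then show False using assms(3) unfolding chordal_def by (elim notE) (rule exI)
  qed
  show ?thesis
    unfolding I H complex_dismantlable_iff graph_dismantlable_iff
    using contractible_imp_dismantles[OF ch] dismantles_imp_contractible[OF _ assms(2)] by blast
qed

end
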